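(* Let $D$ be a weakly locally finite division ring with center $F$. If for all $a,b\in D^*$ there is a positive integer $n$ with $(aba^{-1}b^{-1})^n\in F$, then $D$ is commutative.
   Context: A division ring $D$ is weakly locally finite if for every finite subset $S\subseteq D$, the division subring generated by $S$ is finite dimensional over its own center. *)

theory Defs
  imports Main
begin

definition center :: "'a::division_ring set" where
  "center = {z. \<forall>x. z * x = x * z}"

definition is_division_subring :: "'a::division_ring set \<Rightarrow> bool" where
  "is_division_subring K \<longleftrightarrow> 0 \<in> K \<and> 1 \<in> K \<and>
     (\<forall>x\<in>K. \<forall>y\<in>K. x + y \<in> K \<and> x * y \<in> K) \<and>
     (\<forall>x\<in>K. - x \<in> K) \<and> (\<forall>x\<in>K. x \<noteq> 0 \<longrightarrow> inverse x \<in> K)"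

definition div_subring_gen :: "'a::division_ring set \<Rightarrow> 'a set" where
  "div_subring_gen S = \<Inter> {K. is_division_subring K \<and> S \<subseteq> K}"

definition rel_center :: "'a::division_ring set \<Rightarrow> 'a set" where
  "rel_center K = {z\<in>K. \<forall>x\<in>K. z * x = x * z}"

definition fin_dim_over_center :: "'a::division_ring set \<Rightarrow> bool" where
  "fin_dim_over_center K \<longleftrightarrow> (\<exists>B. finite B \<and> B \<subseteq> K \<and>
     (\<forall>x\<in>K. \<exists>c. (\<forall>b\<in>B. c b \<in> rel_center K) \<and> x = (\<Sum>b\<in>B. c b * b)))"

definition weakly_locally_finite :: "'a::division_ring itself \<Rightarrow> bool" where
  "weakly_locally_finite _ \<longleftrightarrow>
     (\<forall>S::'a set. finite S \<longrightarrow> fin_dim_over_center (div_subring_gen S))"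

end

theory Submission
  imports Defs "HOL-Number_Theory.Cong" "Jordan_Normal_Form.Determinant"
begin

text \<open>
  Let \<open>K\<close> be the division subring generated by two elements. It is finite-dimensional over its
  center \<open>Z\<close>, so the determinant of left multiplication is a norm \<open>K \<rightarrow> Z\<close>, which is \<open>1\<close> on
  commutators and a power map on \<open>Z\<close>; hence all commutators in \<open>K\<close> have finite order. If \<open>K\<close> is not
  commutative, some commutator \<open>u\<close> is not in \<open>Z\<close>, and averaging over the powers of \<open>u\<close> gives \<open>g\<close>
  with \<open>g u g\<^sup>-\<^sup>1 = u\<^sup>j \<noteq> u\<close>. For \<open>z \<in> Z\<close>, the commutator \<open>(1 + z u\<^sup>j) / (1 + z u)\<close> of \<open>g\<close> and
  \<open>1 + z u\<close> then has finite order.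

  In characteristic \<open>0\<close>, take \<open>z = 3\<close>: no element of finite order other than \<open>1\<close> is congruent to
  \<open>1\<close> modulo \<open>3\<close>. In positive characteristic, solving for \<open>z\<close> shows that \<open>Z\<close> is algebraic over the
  prime field, so \<open>g\<close> has finite order and \<open>u\<close> and \<open>g\<close> generate a finite non-commutative division
  ring, against Wedderburn's little theorem.
\<close>

section \<open>Division subrings\<close>

lemma division_subring_closed:
  assumes "is_division_subring K"
  shows "0 \<in> K" "1 \<in> K" "x \<in> K \<Longrightarrow> y \<in> K \<Longrightarrow> x + y \<in> K" "x \<in> K \<Longrightarrow> y \<in> K \<Longrightarrow> x * y \<in> K"
    "x \<in> K \<Longrightarrow> - x \<in> K" "x \<in> K \<Longrightarrow> inverse x \<in> K" "x \<in> K \<Longrightarrow> y \<in> K \<Longrightarrow> x - y \<in> K"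
    "x \<in> K \<Longrightarrow> x ^ n \<in> K"
proof -
  note closed = assms[unfolded is_division_subring_def]
  show "0 \<in> K" "1 \<in> K" "x \<in> K \<Longrightarrow> y \<in> K \<Longrightarrow> x + y \<in> K" "x \<in> K \<Longrightarrow> y \<in> K \<Longrightarrow> x * y \<in> K"
    "x \<in> K \<Longrightarrow> - x \<in> K"
    using closed by auto
  show "x \<in> K \<Longrightarrow> inverse x \<in> K"
    using closed by (cases "x = 0") auto
  show "x \<in> K \<Longrightarrow> y \<in> K \<Longrightarrow> x - y \<in> K"
    using closed by (metis diff_conv_add_uminus)
  show "x \<in> K \<Longrightarrow> x ^ n \<in> K"
    using closed by (induction n) auto
qed

lemma division_subring_sum:
  assumes "is_division_subring K" "\<And>i. i \<in> I \<Longrightarrow> f i \<in> K"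
  shows "sum f I \<in> K"
  using assms(2)
  by (induction I rule: infinite_finite_induct) (auto simp: division_subring_closed[OF assms(1)])

lemma division_subring_of_int:
  assumes "is_division_subring K"
  shows "of_int k \<in> K"
proof -
  have "of_nat n \<in> K" for n
    by (induction n) (auto simp: division_subring_closed[OF assms])
  then show ?thesis
    by (cases k rule: int_cases2) (auto simp: division_subring_closed[OF assms])
qed

lemma mult_of_int_left_commute: "x * (of_int k * y) = of_int k * (x * y)"
  by (metis mult.assoc mult_of_int_commute)

lemma inverse_mult_cancel_left:
  fixes a y :: "'a::division_ring"
  assumes "a \<noteq> 0"
  shows "inverse a * (a * y) = y" "a * (inverse a * y) = y"
  using assms by (simp_all flip: mult.assoc)

lemma division_subring_centralizer:
  assumes "is_division_subring K"
  shows "is_division_subring {z \<in> K. \<forall>x\<in>X. z * x = x * z}"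
proof -
  have "(z * w) * x = x * (z * w)" if "z * x = x * z" "w * x = x * w" for z w x :: 'a
    using that by (metis mult.assoc)
  then show ?thesis
    unfolding is_division_subring_def
    by (auto simp: division_subring_closed[OF assms] distrib_left distrib_right
        mult_commute_imp_mult_inverse_commute)
qed

lemma rel_center_subset: "rel_center K \<subseteq> K"
  by (auto simp: rel_center_def)

lemma rel_center_commute: "z \<in> rel_center K \<Longrightarrow> x \<in> K \<Longrightarrow> z * x = x * z"
  by (auto simp: rel_center_def)

lemma division_subring_rel_center:
  "is_division_subring K \<Longrightarrow> is_division_subring (rel_center K)"
  unfolding rel_center_def by (rule division_subring_centralizer)

lemma of_int_in_rel_center:
  "is_division_subring K \<Longrightarrow> of_int k \<in> rel_center K"
  by (simp add: division_subring_of_int division_subring_rel_center)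

definition conjugation :: "'a::division_ring \<Rightarrow> 'a \<Rightarrow> 'a" where
  "conjugation g x = g * x * inverse g"

lemma conjugation_add: "conjugation g (x + y) = conjugation g x + conjugation g y"
  by (simp add: conjugation_def distrib_left distrib_right)

lemma conjugation_mult: "g \<noteq> 0 \<Longrightarrow> conjugation g (x * y) = conjugation g x * conjugation g y"
  by (simp add: conjugation_def mult.assoc inverse_mult_cancel_left)

lemma conjugation_inverse: "g \<noteq> 0 \<Longrightarrow> conjugation g (inverse x) = inverse (conjugation g x)"
  by (cases "x = 0") (simp_all add: conjugation_def nonzero_inverse_mult_distrib mult.assoc)

lemma conjugation_power: "g \<noteq> 0 \<Longrightarrow> conjugation g (x ^ k) = conjugation g x ^ k"
  by (induction k) (simp_all add: conjugation_mult, simp add: conjugation_def)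

lemma mult_eq_conjugation_mult: "g \<noteq> 0 \<Longrightarrow> g * x = conjugation g x * g"
  by (simp add: conjugation_def mult.assoc)

lemma conjugation_eqI: "g \<noteq> 0 \<Longrightarrow> g * x = y * g \<Longrightarrow> conjugation g x = y"
  by (simp add: conjugation_def mult.assoc)

lemma division_subring_conjugation_vimage:
  assumes subring: "is_division_subring K" and "g \<noteq> 0"
  shows "is_division_subring (conjugation g -` K)"
proof -
  have "conjugation g 0 = 0" "conjugation g 1 = 1" "conjugation g (- x) = - conjugation g x" for x
    using \<open>g \<noteq> 0\<close> by (simp_all add: conjugation_def)
  then show ?thesis
    unfolding is_division_subring_def using \<open>g \<noteq> 0\<close>
    by (auto simp: conjugation_add conjugation_mult conjugation_inverse
        division_subring_closed[OF subring])
qed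

lemma division_subring_gen: "is_division_subring (div_subring_gen S)"
  by (auto simp: div_subring_gen_def is_division_subring_def)

lemma subset_div_subring_gen: "S \<subseteq> div_subring_gen S"
  by (auto simp: div_subring_gen_def)

lemma div_subring_gen_least: "is_division_subring K \<Longrightarrow> S \<subseteq> K \<Longrightarrow> div_subring_gen S \<subseteq> K"
  by (auto simp: div_subring_gen_def)

lemma div_subring_gen_eq: "is_division_subring K \<Longrightarrow> div_subring_gen K = K"
  by (intro equalityI div_subring_gen_least subset_div_subring_gen order_refl)

lemma conjugation_div_subring_gen:
  assumes "g \<noteq> 0" "\<And>x. x \<in> S \<Longrightarrow> conjugation g x \<in> div_subring_gen T" "x \<in> div_subring_gen S"
  shows "conjugation g x \<in> div_subring_gen T"
proof -
  have "div_subring_gen S \<subseteq> conjugation g -` div_subring_gen T"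
    using assms(1,2)
    by (intro div_subring_gen_least division_subring_conjugation_vimage division_subring_gen) auto
  then show ?thesis
    using assms(3) by blast
qed

lemma div_subring_gen_commute:
  assumes "\<And>x y. x \<in> S \<Longrightarrow> y \<in> T \<Longrightarrow> x * y = y * x" "x \<in> div_subring_gen S" "y \<in> div_subring_gen T"
  shows "x * y = y * x"
proof -
  have subring_UNIV: "is_division_subring (UNIV :: 'a set)"
    by (simp add: is_division_subring_def)
  have "div_subring_gen S \<subseteq> {z \<in> UNIV. \<forall>y\<in>T. z * y = y * z}"
    using assms(1) by (intro div_subring_gen_least division_subring_centralizer subring_UNIV) auto
  then have "div_subring_gen T \<subseteq> {z \<in> UNIV. \<forall>y\<in>{x}. z * y = y * z}"
    using assms(2) by (intro div_subring_gen_least division_subring_centralizer subring_UNIV) auto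
  then show ?thesis
    using assms(3) by auto
qed

section \<open>Torsion elements and commutators\<close>

definition torsion :: "'a::monoid_mult \<Rightarrow> bool" where
  "torsion x \<longleftrightarrow> (\<exists>m>0. x ^ m = 1)"

definition commutator :: "'a::division_ring \<Rightarrow> 'a \<Rightarrow> 'a" where
  "commutator a b = a * b * inverse a * inverse b"

lemma torsion_neq_0: "torsion x \<Longrightarrow> x \<noteq> (0 :: 'a::division_ring)"
  by (auto simp: torsion_def power_0_left)

lemma power_diff_eq_1:
  fixes x :: "'a::division_ring"
  assumes "x \<noteq> 0" "k \<le> l" "x ^ k = x ^ l"
  shows "x ^ (l - k) = 1"
proof -
  have "x ^ l = x ^ k * x ^ (l - k)"
    using assms(2) by (simp flip: power_add)
  then show ?thesis
    using assms(1,3) by simp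
qed

lemma torsion_if_finite_orbit:
  fixes x :: "'a::division_ring"
  assumes "x \<noteq> 0" "b \<noteq> 0" "finite V" and orbit: "\<And>k. x ^ k * b \<in> V"
  shows "torsion x"
proof -
  have "\<not> inj (\<lambda>k. x ^ k * b)"
    using \<open>finite V\<close> orbit by (metis finite_imageD finite_subset image_subsetI infinite_UNIV_nat)
  then obtain k l where "k < l" "x ^ k = x ^ l"
    using \<open>b \<noteq> 0\<close> by (auto simp: inj_def) (metis linorder_less_linear)
  then show ?thesis
    using power_diff_eq_1[OF \<open>x \<noteq> 0\<close>, of k l] unfolding torsion_def
    by (intro exI[of _ "l - k"]) simp
qed

lemma finite_division_subring_torsion:
  assumes "is_division_subring A" "finite A" "x \<in> A" "x \<noteq> 0"
  shows "torsion x"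
  using assms by (intro torsion_if_finite_orbit[of x 1 A]) (auto simp: division_subring_closed)

lemma power_eq_power_mod:
  fixes x :: "'a::monoid_mult"
  assumes "x ^ m = 1"
  shows "x ^ k = x ^ (k mod m)"
proof -
  have "x ^ k = x ^ (m * (k div m) + k mod m)"
    by simp
  also have "\<dots> = x ^ (k mod m)"
    using assms by (simp only: power_add power_mult power_one mult_1_left)
  finally show ?thesis .
qed

lemma finite_range_power:
  assumes "torsion x"
  shows "finite (range ((^) x))"
proof -
  obtain m where "m > 0" "x ^ m = 1"
    using assms by (auto simp: torsion_def)
  then have "range ((^) x) \<subseteq> (^) x ` {..<m}"
    using power_eq_power_mod[OF \<open>x ^ m = 1\<close>] by (auto intro!: image_eqI[of _ _ "_ mod m"])
  then show ?thesis
    by (rule finite_subset) simp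
qed

lemma torsion_order:
  fixes x :: "'a::division_ring"
  assumes "torsion x"
  obtains n where "n > 0" "x ^ n = 1" "inj_on ((^) x) {..<n}"
proof -
  define n where "n = (LEAST n. n > 0 \<and> x ^ n = 1)"
  have n_order: "n > 0 \<and> x ^ n = 1"
    using assms unfolding n_def torsion_def by (rule LeastI_ex)
  have "x ^ k \<noteq> x ^ l" if "k < l" "l < n" for k l
    using power_diff_eq_1[OF torsion_neq_0[OF assms], of k l] that
      not_less_Least[of "l - k" "\<lambda>n. n > 0 \<and> x ^ n = 1"]
    unfolding n_def by force
  then have "inj_on ((^) x) {..<n}"
    by (intro linorder_inj_onI') auto
  with n_order show thesis
    using that by blast
qed

lemma commutator_closed:
  "is_division_subring K \<Longrightarrow> a \<in> K \<Longrightarrow> b \<in> K \<Longrightarrow> commutator a b \<in> K"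
  by (simp add: commutator_def division_subring_closed)

lemma commutator_mult: "b \<noteq> 0 \<Longrightarrow> commutator a b * b = conjugation a b"
  by (simp add: commutator_def conjugation_def mult.assoc)

lemma ex_noncentral_commutator:
  assumes subring: "is_division_subring K" and "a \<in> K" "b \<in> K" and noncommuting: "a * b \<noteq> b * a"
  obtains b' where "b' \<in> K" "b' \<noteq> 0" "commutator a b' \<notin> rel_center K"
proof -
  have "a \<noteq> 0" "b \<noteq> 0" "b + 1 \<noteq> 0"
    using noncommuting by (auto simp: add_eq_0_iff2)
  \<comment> \<open>The two commutators determine \<open>b\<close>, by \<open>(d - c) b = 1 - d\<close>.\<close>
  define c d where "c = commutator a b" and "d = commutator a (b + 1)"
  have c_mult: "c * b = conjugation a b"
    by (simp add: c_def commutator_mult \<open>b \<noteq> 0\<close>)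
  have "d * (b + 1) = c * b + conjugation a 1"
    by (simp add: d_def commutator_mult \<open>b + 1 \<noteq> 0\<close> c_mult conjugation_add)
  then have diff_mult: "(d - c) * b = 1 - d"
    using \<open>a \<noteq> 0\<close> by (simp add: conjugation_def algebra_simps)
  have "d \<noteq> c"
  proof
    assume "d = c"
    then have "conjugation a b = b"
      using diff_mult c_mult by simp
    then show False
      using mult_eq_conjugation_mult[OF \<open>a \<noteq> 0\<close>, of b] noncommuting by simp
  qed
  then have "b = inverse (d - c) * (1 - d)"
    by (simp add: diff_mult[symmetric] inverse_mult_cancel_left)
  moreover have "b \<notin> rel_center K"
    using rel_center_commute[of b K a] \<open>a \<in> K\<close> noncommuting by auto
  ultimately have "c \<notin> rel_center K \<or> d \<notin> rel_center K"
    using division_subring_closed[OF division_subring_rel_center[OF subring]] by metis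
  moreover have "b + 1 \<in> K"
    using \<open>b \<in> K\<close> division_subring_closed(2,3)[OF subring] by blast
  ultimately show thesis
    using that \<open>b \<in> K\<close> \<open>b \<noteq> 0\<close> \<open>b + 1 \<noteq> 0\<close> unfolding c_def d_def by blast
qed

section \<open>Left spans\<close>

definition left_span :: "'a::division_ring set \<Rightarrow> 'a set \<Rightarrow> 'a set" where
  "left_span F B = (\<lambda>c. \<Sum>b\<in>B. c b * b) ` (B \<rightarrow> F)"

lemma left_spanI: "(\<And>b. b \<in> B \<Longrightarrow> c b \<in> F) \<Longrightarrow> (\<Sum>b\<in>B. c b * b) \<in> left_span F B"
  by (auto simp: left_span_def)

lemma left_spanE:
  assumes "x \<in> left_span F B"
  obtains c where "\<And>b. b \<in> B \<Longrightarrow> c b \<in> F" "x = (\<Sum>b\<in>B. c b * b)"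
  using assms by (auto simp: left_span_def)

lemma fin_dim_over_center_iff:
  "fin_dim_over_center K \<longleftrightarrow> (\<exists>B. finite B \<and> B \<subseteq> K \<and> K \<subseteq> left_span (rel_center K) B)"
  unfolding fin_dim_over_center_def left_span_def subset_eq image_iff Bex_def Pi_iff by blast

lemma finite_left_span:
  assumes "finite F" "finite B"
  shows "finite (left_span F B)"
proof -
  have "(\<Sum>b\<in>B. c b * b) = (\<Sum>b\<in>B. restrict c B b * b)" for c :: "'a \<Rightarrow> 'a"
    by simp
  then have "left_span F B \<subseteq> (\<lambda>c. \<Sum>b\<in>B. c b * b) ` (B \<rightarrow>\<^sub>E F)"
    unfolding left_span_def by (auto intro!: image_eqI[of _ _ "restrict _ B"])
  then show ?thesis
    by (rule finite_subset) (use assms in \<open>intro finite_imageI finite_PiE\<close>)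
qed

lemma left_span_add:
  assumes "is_division_subring F" "x \<in> left_span F B" "y \<in> left_span F B"
  shows "x + y \<in> left_span F B"
proof -
  obtain c d where "\<And>b. b \<in> B \<Longrightarrow> c b \<in> F" "x = (\<Sum>b\<in>B. c b * b)"
    "\<And>b. b \<in> B \<Longrightarrow> d b \<in> F" "y = (\<Sum>b\<in>B. d b * b)"
    using assms(2,3) by (auto elim!: left_spanE)
  then show ?thesis
    using left_spanI[of B "\<lambda>b. c b + d b" F] division_subring_closed(3)[OF assms(1)]
    by (simp add: distrib_right sum.distrib)
qed

lemma left_span_scale:
  assumes "is_division_subring F" "a \<in> F" "x \<in> left_span F B"
  shows "a * x \<in> left_span F B"
proof -
  obtain c where "\<And>b. b \<in> B \<Longrightarrow> c b \<in> F" "x = (\<Sum>b\<in>B. c b * b)"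
    using assms(3) by (auto elim!: left_spanE)
  then show ?thesis
    using left_spanI[of B "\<lambda>b. a * c b" F] division_subring_closed(4)[OF assms(1,2)]
    by (simp add: sum_distrib_left mult.assoc)
qed

lemma left_span_sum:
  assumes "is_division_subring F" "\<And>i. i \<in> I \<Longrightarrow> f i \<in> left_span F B"
  shows "sum f I \<in> left_span F B"
proof -
  have "0 \<in> left_span F B"
    using left_spanI[of B "\<lambda>_. 0" F] division_subring_closed(1)[OF assms(1)] by simp
  with assms(2) show ?thesis
    by (induction I rule: infinite_finite_induct) (auto intro: left_span_add[OF assms(1)])
qed

lemma left_span_base:
  assumes "is_division_subring F" "finite B" "b \<in> B"
  shows "b \<in> left_span F B"
proof -
  have "(\<Sum>b'\<in>B. (if b' = b then 1 else 0) * b') = b"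
    using assms(2,3) by (simp add: if_distrib[of "\<lambda>x. x * _"] cong: if_cong)
  moreover have "(if b' = b then 1 else 0) \<in> F" for b'
    using division_subring_closed(1,2)[OF assms(1)] by simp
  ultimately show ?thesis
    using left_spanI[of B "\<lambda>b'. if b' = b then 1 else 0" F] by simp
qed

lemma left_span_semilinear:
  assumes subring: "is_division_subring F"
    and scalars: "\<And>c. c \<in> F \<Longrightarrow> \<exists>c'\<in>F. g * c = c' * g"
    and base: "\<And>b. b \<in> B \<Longrightarrow> g * b \<in> left_span F B" and "x \<in> left_span F B"
  shows "g * x \<in> left_span F B"
proof -
  obtain c where c_in: "\<And>b. b \<in> B \<Longrightarrow> c b \<in> F" and x_eq: "x = (\<Sum>b\<in>B. c b * b)"
    using \<open>x \<in> left_span F B\<close> by (auto elim!: left_spanE)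
  have "g * (c b * b) \<in> left_span F B" if "b \<in> B" for b
  proof -
    obtain c' where "c' \<in> F" "g * c b = c' * g"
      using scalars c_in \<open>b \<in> B\<close> by blast
    then show ?thesis
      using left_span_scale[OF subring _ base[OF \<open>b \<in> B\<close>], of c'] by (metis mult.assoc)
  qed
  then show ?thesis
    unfolding x_eq sum_distrib_left by (rule left_span_sum[OF subring])
qed

section \<open>Commutators with a central power\<close>

lemma irredundant_spanning_set_independent:
  assumes subring: "is_division_subring K" and finite: "finite B"
    and spanning: "K \<subseteq> left_span (rel_center K) B"
    and irredundant: "\<And>b. b \<in> B \<Longrightarrow> \<not> K \<subseteq> left_span (rel_center K) (B - {b})"
    and scalars: "\<And>b. b \<in> B \<Longrightarrow> c b \<in> rel_center K"
    and relation: "(\<Sum>b\<in>B. c b * b) = 0" and "k \<in> B"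
  shows "c k = 0"
proof (rule ccontr)
  assume "c k \<noteq> 0"
  note center = division_subring_rel_center[OF subring]
  have "c k * k = (\<Sum>b\<in>B-{k}. - c b * b)"
    using relation by (simp add: sum.remove[OF finite \<open>k \<in> B\<close>] eq_neg_iff_add_eq_0 sum_negf)
  moreover have "\<dots> \<in> left_span (rel_center K) (B - {k})"
    using scalars division_subring_closed(5)[OF center] by (intro left_spanI) simp
  ultimately have "inverse (c k) * (c k * k) \<in> left_span (rel_center K) (B - {k})"
    using left_span_scale[OF center division_subring_closed(6)[OF center]] scalars[OF \<open>k \<in> B\<close>]
    by simp
  then have k_in_span: "k \<in> left_span (rel_center K) (B - {k})"
    using \<open>c k \<noteq> 0\<close> by (simp add: inverse_mult_cancel_left)
  have "left_span (rel_center K) B \<subseteq> left_span (rel_center K) (B - {k})"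
  proof
    fix x assume "x \<in> left_span (rel_center K) B"
    then obtain d where d_scalars: "\<And>b. b \<in> B \<Longrightarrow> d b \<in> rel_center K"
      and x_eq: "x = (\<Sum>b\<in>B. d b * b)"
      by (auto elim!: left_spanE)
    show "x \<in> left_span (rel_center K) (B - {k})"
      unfolding x_eq sum.remove[OF finite \<open>k \<in> B\<close>] using d_scalars \<open>k \<in> B\<close> k_in_span
      by (intro left_span_add[OF center] left_span_scale[OF center] left_spanI) auto
  qed
  with spanning irredundant[OF \<open>k \<in> B\<close>] show False
    by blast
qed

lemma ex_irredundant_spanning_set:
  assumes "fin_dim_over_center K"
  obtains B where "finite B" "B \<subseteq> K" "K \<subseteq> left_span (rel_center K) B"
    "\<And>b. b \<in> B \<Longrightarrow> \<not> K \<subseteq> left_span (rel_center K) (B - {b})"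
proof -
  define spanning where
    "spanning B \<longleftrightarrow> finite B \<and> B \<subseteq> K \<and> K \<subseteq> left_span (rel_center K) B" for B
  have "\<exists>B. spanning B"
    using assms by (simp add: fin_dim_over_center_iff spanning_def)
  then obtain B where "spanning B" and minimal: "\<And>B'. spanning B' \<Longrightarrow> card B \<le> card B'"
    using ex_has_least_nat[of spanning _ card] by metis
  then have "\<not> spanning (B - {b})" if "b \<in> B" for b
    using minimal[of "B - {b}"] card_Diff1_less[of B b] that by (auto simp: spanning_def)
  with \<open>spanning B\<close> show thesis
    by (intro that[of B]) (auto simp: spanning_def)
qed

locale basis_over_center =
  fixes K :: "'a::division_ring set" and N :: nat and e :: "nat \<Rightarrow> 'a"
  assumes division_subring: "is_division_subring K"
    and basis_closed: "i < N \<Longrightarrow> e i \<in> K"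
    and spanning: "x \<in> K \<Longrightarrow> \<exists>c. (\<forall>i<N. c i \<in> rel_center K) \<and> x = (\<Sum>i<N. c i * e i)"
    and independent: "\<forall>i<N. c i \<in> rel_center K \<Longrightarrow> (\<Sum>i<N. c i * e i) = 0 \<Longrightarrow> i < N \<Longrightarrow> c i = 0"

lemma ex_basis_over_center:
  assumes subring: "is_division_subring K" and "fin_dim_over_center K"
  obtains N e where "basis_over_center K N e"
proof -
  obtain B where finite: "finite B" and "B \<subseteq> K" and spanning: "K \<subseteq> left_span (rel_center K) B"
    and irredundant: "\<And>b. b \<in> B \<Longrightarrow> \<not> K \<subseteq> left_span (rel_center K) (B - {b})"
    using ex_irredundant_spanning_set[OF assms(2)] by metis
  obtain e where bij: "bij_betw e {..<card B} B"
    using ex_bij_betw_nat_finite[OF finite] by (auto simp: atLeast0LessThan)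
  then have e_in: "e i \<in> B" if "i < card B" for i
    using that by (auto simp: bij_betw_def)
  have reindex: "(\<Sum>b\<in>B. f b) = (\<Sum>i<card B. f (e i))" for f :: "'a \<Rightarrow> 'a"
    by (rule sum.reindex_bij_betw[OF bij, symmetric])
  have "basis_over_center K (card B) e"
  proof
    fix x assume "x \<in> K"
    then obtain c where "\<And>b. b \<in> B \<Longrightarrow> c b \<in> rel_center K" "x = (\<Sum>b\<in>B. c b * b)"
      using spanning by (blast elim: left_spanE)
    then show "\<exists>c. (\<forall>i<card B. c i \<in> rel_center K) \<and> x = (\<Sum>i<card B. c i * e i)"
      using e_in by (intro exI[of _ "\<lambda>i. c (e i)"]) (simp add: reindex)
  next
    fix c i assume scalars: "\<forall>i<card B. c i \<in> rel_center K"
      and relation: "(\<Sum>i<card B. c i * e i) = 0" and "i < card B"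
    define index where "index = inv_into {..<card B} e"
    have index_less: "index b < card B" if "b \<in> B" for b
      using bij that inv_into_into[of b e "{..<card B}"] by (auto simp: index_def bij_betw_def)
    have index_e: "index (e i) = i" if "i < card B" for i
      using bij that by (auto simp: index_def bij_betw_def)
    have "c (index (e i)) = 0"
    proof (rule irredundant_spanning_set_independent[OF subring finite spanning irredundant,
          where c = "\<lambda>b. c (index b)"])
      show "(\<Sum>b\<in>B. c (index b) * b) = 0"
        by (simp add: reindex index_e relation)
    qed (use scalars index_less e_in[OF \<open>i < card B\<close>] in auto)
    then show "c i = 0"
      by (simp add: index_e \<open>i < card B\<close>)
  qed (use subring \<open>B \<subseteq> K\<close> e_in in auto)
  then show thesis
    by (rule that)
qed

text \<open>
  Determinants need a commutative ring as a type, but the center of \<open>K\<close> depends on the variable \<open>K\<close>.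
  The product of the centers of all division subrings is a single type with all of them as factors.
\<close>

typedef (overloaded) 'a centers =
  "{f :: 'a::division_ring set \<Rightarrow> 'a. \<forall>S. f S \<in> rel_center (div_subring_gen S)}"
  morphisms component Abs_centers
  by (intro exI[of _ "\<lambda>_. 0"])
    (simp add: division_subring_closed division_subring_rel_center division_subring_gen)

setup_lifting type_definition_centers

lemmas rel_center_gen_closed =
  division_subring_closed[OF division_subring_rel_center[OF division_subring_gen]]

instantiation centers :: (division_ring) comm_ring_1
begin

lift_definition zero_centers :: "'a centers" is "\<lambda>_. 0"
  by (simp add: rel_center_gen_closed)

lift_definition one_centers :: "'a centers" is "\<lambda>_. 1"
  by (simp add: rel_center_gen_closed)

lift_definition plus_centers :: "'a centers \<Rightarrow> 'a centers \<Rightarrow> 'a centers" is "\<lambda>f g S. f S + g S"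
  by (simp add: rel_center_gen_closed)

lift_definition times_centers :: "'a centers \<Rightarrow> 'a centers \<Rightarrow> 'a centers" is "\<lambda>f g S. f S * g S"
  by (simp add: rel_center_gen_closed)

lift_definition minus_centers :: "'a centers \<Rightarrow> 'a centers \<Rightarrow> 'a centers" is "\<lambda>f g S. f S - g S"
  by (simp add: rel_center_gen_closed)

lift_definition uminus_centers :: "'a centers \<Rightarrow> 'a centers" is "\<lambda>f S. - f S"
  by (simp add: rel_center_gen_closed)

instance
proof
  fix a b :: "'a centers"
  show "a * b = b * a"
    by transfer (metis rel_center_commute rel_center_subset subsetD)
qed (transfer; simp add: algebra_simps fun_eq_iff)+

end

lemma component_power: "component (z ^ n) S = component z S ^ n"
  by (induction n) (simp_all add: one_centers.rep_eq times_centers.rep_eq)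

lemma component_in_rel_center: "is_division_subring K \<Longrightarrow> component z K \<in> rel_center K"
  using component[of z] by (auto dest: spec[of _ K] simp: div_subring_gen_eq)

lift_definition concentrated :: "'a::division_ring set \<Rightarrow> 'a \<Rightarrow> 'a centers" is
  "\<lambda>K z S. if S = K \<and> z \<in> rel_center (div_subring_gen K) then z else 0"
  by (simp add: rel_center_gen_closed)

lemma component_concentrated:
  "is_division_subring K \<Longrightarrow> z \<in> rel_center K \<Longrightarrow>
    component (concentrated K z) S = (if S = K then z else 0)"
  by (simp add: concentrated.rep_eq div_subring_gen_eq)

lemma concentrated_zero: "concentrated K 0 = 0"
  by transfer auto

lemma concentrated_mult:
  assumes "is_division_subring K" "x \<in> rel_center K" "y \<in> rel_center K"
  shows "concentrated K (x * y) = concentrated K x * concentrated K y"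
  using assms division_subring_closed(4)[OF division_subring_rel_center[OF assms(1)]]
  by (intro component_inject[THEN iffD1])
    (auto simp: fun_eq_iff component_concentrated times_centers.rep_eq)

lemma concentrated_add:
  assumes "is_division_subring K" "x \<in> rel_center K" "y \<in> rel_center K"
  shows "concentrated K (x + y) = concentrated K x + concentrated K y"
  using assms division_subring_closed(3)[OF division_subring_rel_center[OF assms(1)]]
  by (intro component_inject[THEN iffD1])
    (auto simp: fun_eq_iff component_concentrated plus_centers.rep_eq)

lemma concentrated_sum:
  assumes "is_division_subring K" "\<And>i. i \<in> I \<Longrightarrow> f i \<in> rel_center K"
  shows "concentrated K (sum f I) = (\<Sum>i\<in>I. concentrated K (f i))"
  using assms(2)
  by (induction I rule: infinite_finite_induct)
    (auto simp: concentrated_zero concentrated_add[OF assms(1)]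
      division_subring_sum[OF division_subring_rel_center[OF assms(1)]])

context basis_over_center
begin

lemmas closed = division_subring_closed[OF division_subring]
lemmas center_closed = division_subring_closed[OF division_subring_rel_center[OF division_subring]]

definition coord :: "'a \<Rightarrow> nat \<Rightarrow> 'a" where
  "coord x = (SOME c. (\<forall>i<N. c i \<in> rel_center K) \<and> x = (\<Sum>i<N. c i * e i))"

lemma coord_in_rel_center: "x \<in> K \<Longrightarrow> i < N \<Longrightarrow> coord x i \<in> rel_center K"
  using someI_ex[OF spanning, of x] unfolding coord_def by blast

lemma sum_coord: "x \<in> K \<Longrightarrow> (\<Sum>i<N. coord x i * e i) = x"
  using someI_ex[OF spanning, of x] unfolding coord_def by simp

lemma coord_eqI:
  assumes "x \<in> K" "x = (\<Sum>i<N. c i * e i)" "\<And>i. i < N \<Longrightarrow> c i \<in> rel_center K" "i < N"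
  shows "coord x i = c i"
proof -
  have "(\<Sum>i<N. (coord x i - c i) * e i) = 0"
    using sum_coord[OF assms(1)] assms(2) by (simp add: left_diff_distrib sum_subtractf)
  then have "coord x i - c i = 0"
    by (rule independent[rotated])
      (use assms in \<open>auto intro!: center_closed(7) coord_in_rel_center\<close>)
  then show ?thesis
    by simp
qed

lemma coord_mult:
  assumes "x \<in> K" "y \<in> K" "i < N"
  shows "coord (x * y) i = (\<Sum>k<N. coord (x * e k) i * coord y k)"
proof (rule coord_eqI[OF closed(4)[OF \<open>x \<in> K\<close> \<open>y \<in> K\<close>] _ _ \<open>i < N\<close>])
  have x_mult_in: "x * e k \<in> K" if "k < N" for k
    by (intro closed(4) \<open>x \<in> K\<close> basis_closed that)
  have "x * y = (\<Sum>k<N. x * (coord y k * e k))"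
    by (simp add: sum_distrib_left[symmetric] sum_coord \<open>y \<in> K\<close>)
  also have "\<dots> = (\<Sum>k<N. coord y k * (x * e k))"
    using rel_center_commute[OF coord_in_rel_center[OF \<open>y \<in> K\<close>] \<open>x \<in> K\<close>]
    by (intro sum.cong refl) (metis lessThan_iff mult.assoc)
  also have "\<dots> = (\<Sum>k<N. \<Sum>i<N. coord y k * (coord (x * e k) i * e i))"
    by (intro sum.cong refl) (simp add: sum_distrib_left[symmetric] sum_coord x_mult_in)
  also have "\<dots> = (\<Sum>i<N. \<Sum>k<N. coord y k * (coord (x * e k) i * e i))"
    by (rule sum.swap)
  also have "\<dots> = (\<Sum>i<N. (\<Sum>k<N. coord (x * e k) i * coord y k) * e i)"
    unfolding sum_distrib_right
  proof (intro sum.cong refl)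
    fix i k assume "i \<in> {..<N}" "k \<in> {..<N}"
    then have "coord y k \<in> rel_center K" "coord (x * e k) i \<in> K"
      using coord_in_rel_center[OF \<open>y \<in> K\<close>]
        subsetD[OF rel_center_subset coord_in_rel_center[OF x_mult_in]] by auto
    then have "coord y k * coord (x * e k) i = coord (x * e k) i * coord y k"
      by (rule rel_center_commute)
    then show "coord y k * (coord (x * e k) i * e i) = coord (x * e k) i * coord y k * e i"
      by (metis mult.assoc)
  qed
  finally show "x * y = \<dots>" .
  show "(\<Sum>k<N. coord (x * e k) j * coord y k) \<in> rel_center K" if "j < N" for j
    using that by (intro division_subring_sum division_subring_rel_center division_subring
        center_closed(4) coord_in_rel_center x_mult_in \<open>y \<in> K\<close>) auto
qed

definition mult_matrix :: "'a \<Rightarrow> 'a centers mat" where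
  "mult_matrix x = mat N N (\<lambda>(i, j). concentrated K (coord (x * e j) i))"

lemma mult_matrix_carrier: "mult_matrix x \<in> carrier_mat N N"
  by (simp add: mult_matrix_def)

lemma mult_matrix_mult:
  assumes "x \<in> K" "y \<in> K"
  shows "mult_matrix (x * y) = mult_matrix x * mult_matrix y"
proof (rule eq_matI)
  fix i j
  assume "i < dim_row (mult_matrix x * mult_matrix y)" "j < dim_col (mult_matrix x * mult_matrix y)"
  then have "i < N" "j < N"
    by (auto simp: mult_matrix_def)
  have y_mult_in: "y * e j \<in> K"
    by (intro closed(4) \<open>y \<in> K\<close> basis_closed \<open>j < N\<close>)
  have in_center: "coord (x * e k) i \<in> rel_center K" "coord (y * e j) k \<in> rel_center K"
    if "k < N" for k
    using that \<open>i < N\<close> \<open>x \<in> K\<close> y_mult_in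
    by (auto intro!: coord_in_rel_center closed(4) basis_closed)
  have "concentrated K (coord (x * (y * e j)) i) =
      concentrated K (\<Sum>k<N. coord (x * e k) i * coord (y * e j) k)"
    by (simp add: coord_mult[OF \<open>x \<in> K\<close> y_mult_in \<open>i < N\<close>])
  also have "\<dots> = (\<Sum>k<N. concentrated K (coord (x * e k) i) * concentrated K (coord (y * e j) k))"
    using in_center center_closed(4)
    by (subst concentrated_sum[OF division_subring])
      (auto simp: concentrated_mult[OF division_subring])
  finally show "mult_matrix (x * y) $$ (i, j) = (mult_matrix x * mult_matrix y) $$ (i, j)"
    using \<open>i < N\<close> \<open>j < N\<close>
    by (simp add: mult_matrix_def scalar_prod_def mult.assoc atLeast0LessThan)
qed (auto simp: mult_matrix_def)

lemma mult_matrix_center: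
  assumes "z \<in> rel_center K"
  shows "mult_matrix z = concentrated K z \<cdot>\<^sub>m 1\<^sub>m N"
proof (rule eq_matI)
  fix i j
  assume "i < dim_row (concentrated K z \<cdot>\<^sub>m 1\<^sub>m N)" "j < dim_col (concentrated K z \<cdot>\<^sub>m 1\<^sub>m N)"
  then have "i < N" "j < N"
    by auto
  have "coord (z * e j) i = (if i = j then z else 0)"
  proof (rule coord_eqI[OF _ _ _ \<open>i < N\<close>])
    show "z * e j \<in> K"
      using assms rel_center_subset by (intro closed(4) basis_closed \<open>j < N\<close>) auto
    show "z * e j = (\<Sum>i<N. (if i = j then z else 0) * e i)"
      using \<open>j < N\<close> by (simp add: if_distrib[of "\<lambda>x. x * _"] cong: if_cong)
  qed (use assms center_closed(1) in auto)
  then show "mult_matrix z $$ (i, j) = (concentrated K z \<cdot>\<^sub>m 1\<^sub>m N) $$ (i, j)"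
    using \<open>i < N\<close> \<open>j < N\<close> by (simp add: mult_matrix_def concentrated_zero)
qed (auto simp: mult_matrix_def)

definition norm_over_center :: "'a \<Rightarrow> 'a" where
  "norm_over_center x = component (det (mult_matrix x)) K"

lemma norm_over_center_mult:
  "x \<in> K \<Longrightarrow> y \<in> K \<Longrightarrow> norm_over_center (x * y) = norm_over_center x * norm_over_center y"
  by (simp add: norm_over_center_def mult_matrix_mult times_centers.rep_eq
      det_mult[OF mult_matrix_carrier mult_matrix_carrier])

lemma norm_over_center_center: "z \<in> rel_center K \<Longrightarrow> norm_over_center z = z ^ N"
  by (simp add: norm_over_center_def mult_matrix_center component_power
      component_concentrated[OF division_subring])

lemma norm_over_center_commute:
  "norm_over_center x * norm_over_center y = norm_over_center y * norm_over_center x"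
  unfolding norm_over_center_def
  using component_in_rel_center[OF division_subring] rel_center_subset
  by (metis rel_center_commute subsetD)

lemma norm_over_center_inverse:
  assumes "x \<in> K" "x \<noteq> 0"
  shows "norm_over_center x * norm_over_center (inverse x) = 1"
  using norm_over_center_mult[OF assms(1) closed(6)[OF assms(1)]] assms(2)
    norm_over_center_center[OF center_closed(2)] by simp

lemma norm_over_center_commutator:
  assumes "a \<in> K" "b \<in> K" "a \<noteq> 0" "b \<noteq> 0"
  shows "norm_over_center (commutator a b) = 1"
proof -
  have "norm_over_center (commutator a b) = norm_over_center a * norm_over_center b *
      norm_over_center (inverse a) * norm_over_center (inverse b)"
    using assms by (simp add: commutator_def norm_over_center_mult closed)
  also have "\<dots> = norm_over_center b * (norm_over_center a * norm_over_center (inverse a)) *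
      norm_over_center (inverse b)"
    by (simp add: norm_over_center_commute[of a b] mult.assoc)
  also have "\<dots> = 1"
    using assms by (simp add: norm_over_center_inverse)
  finally show ?thesis .
qed

lemma dimension_pos: "N > 0"
proof (rule ccontr)
  assume "\<not> N > 0"
  then show False
    using sum_coord[OF closed(2)] by simp
qed

lemma torsion_commutator_if_power_central:
  assumes "a \<in> K" "b \<in> K" "a \<noteq> 0" "b \<noteq> 0" "n > 0" and central: "commutator a b ^ n \<in> rel_center K"
  shows "torsion (commutator a b)"
proof -
  have "norm_over_center (commutator a b ^ k) = 1" for k
  proof (induction k)
    case 0
    show ?case
      using norm_over_center_center[OF center_closed(2)] by simp
  next
    case (Suc k)
    have "commutator a b \<in> K"
      by (intro commutator_closed division_subring assms(1,2))
    with Suc show ?case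
      by (simp add: norm_over_center_mult closed(8) norm_over_center_commutator assms(1-4))
  qed
  then have "(commutator a b ^ n) ^ N = 1"
    using norm_over_center_center[OF central] by simp
  then have "commutator a b ^ (n * N) = 1"
    by (simp add: power_mult)
  then show ?thesis
    using \<open>n > 0\<close> dimension_pos unfolding torsion_def by (intro exI[of _ "n * N"]) simp
qed

end

section \<open>Eigenvectors and intertwiners\<close>

lemma vandermonde_independent:
  fixes a w :: "nat \<Rightarrow> 'a::division_ring"
  assumes "inj_on a {..<m}" and "\<And>i k. i < m \<Longrightarrow> k < m \<Longrightarrow> a i * a k = a k * a i"
    and "\<And>k. (\<Sum>i<m. a i ^ k * w i) = 0" and "i < m"
  shows "w i = 0"
  using assms
proof (induction m arbitrary: w i)
  case (Suc m)
  have difference: "a i ^ k * ((a i - a m) * w i) = a i ^ Suc k * w i - a m * (a i ^ k * w i)"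
    if "i < Suc m" for i k
  proof -
    have "a i ^ k * a m = a m * a i ^ k"
      using Suc.prems(2) that by (intro power_commuting_commutes) auto
    then show ?thesis
      by (simp add: right_diff_distrib left_diff_distrib power_Suc2 flip: mult.assoc
          del: power_Suc)
  qed
  have "(a j - a m) * w j = 0" if "j < m" for j
  proof (rule Suc.IH[OF _ _ _ that])
    fix k
    have "(\<Sum>i<m. a i ^ k * ((a i - a m) * w i)) = (\<Sum>i<Suc m. a i ^ k * ((a i - a m) * w i))"
      by simp
    also have "\<dots> = (\<Sum>i<Suc m. a i ^ Suc k * w i) - a m * (\<Sum>i<Suc m. a i ^ k * w i)"
      unfolding sum_distrib_left sum_subtractf[symmetric]
      by (intro sum.cong refl difference) simp
    finally show "(\<Sum>i<m. a i ^ k * ((a i - a m) * w i)) = 0"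
      by (simp only: Suc.prems(3)) simp
  qed (use Suc.prems(1,2) in \<open>auto intro: inj_on_subset\<close>)
  moreover have "a j \<noteq> a m" if "j < m" for j
    using that inj_onD[OF Suc.prems(1), of j m] by auto
  ultimately have w_zero: "w j = 0" if "j < m" for j
    using that by simp
  then have "w m = 0"
    using Suc.prems(3)[of 0] by simp
  with w_zero Suc.prems(4) show ?case
    by (auto simp: less_Suc_eq)
qed simp

definition intertwiner :: "'a::division_ring \<Rightarrow> 'a \<Rightarrow> nat \<Rightarrow> 'a \<Rightarrow> 'a" where
  "intertwiner a b n w = (\<Sum>k<n. a ^ k * w * inverse b ^ k)"

lemma intertwiner_commute:
  assumes "b \<noteq> 0" "a ^ n * w = w * b ^ n"
  shows "a * intertwiner a b n w = intertwiner a b n w * b"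
proof -
  define f where "f k = a ^ k * w * inverse b ^ k" for k
  have "f n = w * b ^ n * inverse b ^ n"
    by (simp add: f_def assms(2))
  also have "\<dots> = f 0"
    using \<open>b \<noteq> 0\<close> by (simp add: f_def mult.assoc power_inverse)
  finally have "(\<Sum>k<n. f (Suc k)) = (\<Sum>k<n. f k)"
    using sum.lessThan_Suc_shift[of f n] by simp
  moreover have "f (Suc k) = a * f k * inverse b" for k
    by (simp only: f_def power_Suc[of a] power_Suc2[of "inverse b"] mult.assoc)
  then have "a * f k = f (Suc k) * b" for k
    using \<open>b \<noteq> 0\<close> by (simp add: mult.assoc)
  ultimately show ?thesis
    by (simp add: intertwiner_def f_def[symmetric] sum_distrib_left sum_distrib_right[symmetric])
qed

lemma commute_if_intertwiners_commute:
  assumes inj: "inj_on ((^) u) {..<n}" and "n > 0"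
    and intertwiners: "\<And>j. u * intertwiner (u ^ j) u n w = intertwiner (u ^ j) u n w * u"
  shows "u * w = w * u"
proof -
  define defect where "defect k = u * (w * inverse u ^ k) - w * inverse u ^ k * u" for k
  have "(\<Sum>k<n. (u ^ k) ^ j * defect k) =
      u * intertwiner (u ^ j) u n w - intertwiner (u ^ j) u n w * u" for j
    unfolding intertwiner_def sum_distrib_left sum_distrib_right sum_subtractf[symmetric]
  proof (intro sum.cong refl)
    fix k
    have "(u ^ k) ^ j = (u ^ j) ^ k" "u * (u ^ j) ^ k = (u ^ j) ^ k * u"
      by (simp_all add: mult.commute power_commutes flip: power_mult)
    then show "(u ^ k) ^ j * defect k =
        u * ((u ^ j) ^ k * w * inverse u ^ k) - (u ^ j) ^ k * w * inverse u ^ k * u"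
      by (simp add: defect_def right_diff_distrib flip: mult.assoc)
  qed
  then have "(\<Sum>k<n. (u ^ k) ^ j * defect k) = 0" for j
    by (simp add: intertwiners)
  then have "defect 0 = 0"
    by (rule vandermonde_independent[OF inj _ _ \<open>n > 0\<close>, rotated])
      (simp add: add.commute flip: power_add)
  then show ?thesis
    by (simp add: defect_def)
qed

lemma torsion_conjugate_to_power:
  fixes u w :: "'a::division_ring"
  assumes subring: "is_division_subring K" and "u \<in> K" "torsion u" "w \<in> K" "u * w \<noteq> w * u"
  obtains g j where "g \<in> K" "g \<noteq> 0" "g * u = u ^ j * g" "g * u \<noteq> u * g"
proof -
  obtain n where "n > 0" "u ^ n = 1" and inj: "inj_on ((^) u) {..<n}"
    using torsion_order[OF \<open>torsion u\<close>] .
  have intertwines: "u ^ j * intertwiner (u ^ j) u n w = intertwiner (u ^ j) u n w * u" for j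
  proof -
    have "(u ^ j) ^ n = 1"
      using \<open>u ^ n = 1\<close> by (metis power_mult mult.commute power_one)
    then show ?thesis
      using \<open>u ^ n = 1\<close> by (intro intertwiner_commute torsion_neq_0[OF \<open>torsion u\<close>]) simp
  qed
  obtain j where "u * intertwiner (u ^ j) u n w \<noteq> intertwiner (u ^ j) u n w * u"
    using commute_if_intertwiners_commute[OF inj \<open>n > 0\<close>, of w] \<open>u * w \<noteq> w * u\<close> by blast
  moreover have "intertwiner (u ^ j) u n w \<in> K"
    unfolding intertwiner_def using \<open>u \<in> K\<close> \<open>w \<in> K\<close>
    by (intro division_subring_sum[OF subring] division_subring_closed[OF subring])
  ultimately show thesis
    using that[of "intertwiner (u ^ j) u n w" j] intertwines by force
qed

section \<open>Wedderburn's little theorem\<close>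

lemma card_image_mult_le:
  assumes "finite A" "\<And>y. y \<in> f ` A \<Longrightarrow> k \<le> card {x \<in> A. f x = y}"
  shows "k * card (f ` A) \<le> card A"
proof -
  have "k * card (f ` A) = (\<Sum>y\<in>f ` A. k)"
    by simp
  also have "\<dots> \<le> (\<Sum>y\<in>f ` A. card {x \<in> A. f x = y})"
    by (rule sum_mono) (rule assms(2))
  also have "\<dots> = card A"
    using sum.image_gen[OF assms(1), of "\<lambda>_. 1::nat" f] by simp
  finally show ?thesis .
qed

locale cyclic_extension =
  fixes E :: "'a::division_ring set" and g u :: 'a and s :: nat
  assumes division_subring: "is_division_subring E"
    and commute: "x \<in> E \<Longrightarrow> y \<in> E \<Longrightarrow> x * y = y * x"
    and g_neq_0: "g \<noteq> 0"
    and normalizes: "x \<in> E \<Longrightarrow> conjugation g x \<in> E"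
    and power_in: "g ^ s \<in> E" and s_pos: "s > 0"
    and u_in: "u \<in> E" and moves: "0 < i \<Longrightarrow> i < s \<Longrightarrow> g ^ i * u \<noteq> u * g ^ i"
begin

lemmas closed = division_subring_closed[OF division_subring]

lemma conjugation_power_closed: "x \<in> E \<Longrightarrow> conjugation (g ^ i) x \<in> E"
proof (induction i)
  case (Suc i)
  have "conjugation (g ^ Suc i) x = conjugation g (conjugation (g ^ i) x)"
    using g_neq_0 by (simp add: conjugation_def nonzero_inverse_mult_distrib mult.assoc)
  with Suc show ?case
    by (simp add: normalizes)
qed (simp add: conjugation_def)

lemma inj_on_conjugation_power: "inj_on (\<lambda>i. conjugation (g ^ i) u) {..<s}"
proof (rule linorder_inj_onI')
  fix i k assume "i \<in> {..<s}" "k \<in> {..<s}" "i < k"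
  show "conjugation (g ^ i) u \<noteq> conjugation (g ^ k) u"
  proof
    assume conjugation_eq: "conjugation (g ^ i) u = conjugation (g ^ k) u"
    have "g ^ i * (g ^ (k - i) * u) = g ^ k * u"
      using \<open>i < k\<close> by (simp flip: mult.assoc power_add)
    also have "\<dots> = conjugation (g ^ i) u * g ^ k"
      using g_neq_0 by (simp add: mult_eq_conjugation_mult conjugation_eq)
    also have "\<dots> = conjugation (g ^ i) u * g ^ i * g ^ (k - i)"
      using \<open>i < k\<close> by (simp add: mult.assoc flip: power_add)
    also have "\<dots> = g ^ i * (u * g ^ (k - i))"
      using g_neq_0 by (simp add: mult_eq_conjugation_mult[symmetric] mult.assoc)
    finally have "g ^ (k - i) * u = u * g ^ (k - i)"
      using g_neq_0 by simp
    then show False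
      using moves[of "k - i"] \<open>i < k\<close> \<open>k \<in> {..<s}\<close> by (simp add: less_imp_diff_less)
  qed
qed

definition coset :: "'a set" where
  "coset = (\<lambda>c. c * g) ` (E - {0})"

lemma coset_neq_0: "h \<in> coset \<Longrightarrow> h \<noteq> 0"
  using g_neq_0 by (auto simp: coset_def)

lemma coset_power:
  assumes "h \<in> coset"
  obtains c where "c \<in> E" "c \<noteq> 0" "h ^ i = c * g ^ i"
proof -
  obtain d where "d \<in> E" "d \<noteq> 0" and h_eq: "h = d * g"
    using assms by (auto simp: coset_def)
  have "\<exists>c\<in>E. c \<noteq> 0 \<and> h ^ i = c * g ^ i"
  proof (induction i)
    case 0
    show ?case
      using closed(2) by (intro bexI[of _ 1]) auto
  next
    case (Suc i)
    then obtain c where "c \<in> E" "c \<noteq> 0" and power_eq: "h ^ i = c * g ^ i"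
      by blast
    have "h ^ Suc i = d * (g * c) * g ^ i"
      by (simp add: power_eq) (simp add: h_eq mult.assoc)
    also have "\<dots> = d * conjugation g c * g ^ Suc i"
      by (simp add: mult_eq_conjugation_mult[OF g_neq_0] mult.assoc)
    finally show ?case
      using \<open>c \<in> E\<close> \<open>c \<noteq> 0\<close> \<open>d \<in> E\<close> \<open>d \<noteq> 0\<close> g_neq_0 normalizes
      by (intro bexI[of _ "d * conjugation g c"]) (auto simp: closed conjugation_def)
  qed
  then show thesis
    using that by blast
qed

lemma coset_power_mult:
  assumes "h \<in> coset" "x \<in> E"
  shows "h ^ i * x = conjugation (g ^ i) x * h ^ i"
proof -
  obtain c where "c \<in> E" and power_eq: "h ^ i = c * g ^ i"
    using coset_power[OF assms(1)] .
  have "h ^ i * x = c * conjugation (g ^ i) x * g ^ i"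
    using g_neq_0 by (simp add: power_eq mult.assoc mult_eq_conjugation_mult)
  also have "\<dots> = conjugation (g ^ i) x * h ^ i"
    using commute[OF \<open>c \<in> E\<close> conjugation_power_closed[OF \<open>x \<in> E\<close>]]
    by (simp add: power_eq mult.assoc)
  finally show ?thesis .
qed

lemma coset_power_in: "h \<in> coset \<Longrightarrow> h ^ s \<in> E"
  using power_in closed(4) by (metis coset_power)

lemma conjugations_of_u_independent:
  assumes "\<And>k. (\<Sum>i<s. conjugation (g ^ i) u ^ k * w i) = 0" "i < s"
  shows "w i = 0"
  by (rule vandermonde_independent[OF inj_on_conjugation_power _ assms])
    (intro commute conjugation_power_closed u_in)

lemma coset_power_quotient_in:
  assumes "h \<in> coset" "h' \<in> coset"
  shows "h' ^ i * inverse (h ^ i) \<in> E"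
proof -
  obtain c c' where "c \<in> E" "c \<noteq> 0" "h ^ i = c * g ^ i" "c' \<in> E" "h' ^ i = c' * g ^ i"
    using coset_power[OF assms(1)] coset_power[OF assms(2)] by metis
  moreover from this have "h' ^ i * inverse (h ^ i) = c' * inverse c"
    using g_neq_0 by (simp add: nonzero_inverse_mult_distrib mult.assoc inverse_mult_cancel_left)
  ultimately show ?thesis
    by (simp add: closed)
qed

text \<open>Hilbert's Theorem 90: with \<open>h' = c h\<close>, the hypothesis says that \<open>c\<close> has norm 1.\<close>

lemma conjugate_if_power_eq:
  assumes h_in: "h \<in> coset" and h'_in: "h' \<in> coset" and power_eq: "h ^ s = h' ^ s"
  obtains b where "b \<in> E - {0}" "h' = conjugation b h"
proof -
  define b where "b k = intertwiner h' h s (u ^ k)" for k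
  have b_intertwines: "h' * b k = b k * h" for k
    unfolding b_def
  proof (rule intertwiner_commute[OF coset_neq_0[OF h_in]])
    show "h' ^ s * u ^ k = u ^ k * h ^ s"
      unfolding power_eq[symmetric] by (intro commute coset_power_in[OF h_in] closed(8) u_in)
  qed
  have b_eq: "b k = (\<Sum>i<s. conjugation (g ^ i) (u ^ k) * (h' ^ i * inverse (h ^ i)))" for k
    unfolding b_def intertwiner_def
    by (simp add: coset_power_mult[OF h'_in closed(8)[OF u_in]] mult.assoc power_inverse)
  have b_in: "b k \<in> E" for k
    unfolding b_eq by (intro division_subring_sum[OF division_subring] closed(4)
        coset_power_quotient_in h_in h'_in conjugation_power_closed closed(8) u_in)
  have "\<exists>k. b k \<noteq> 0"
  proof (rule ccontr)
    assume "\<nexists>k. b k \<noteq> 0"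
    then have "(\<Sum>i<s. conjugation (g ^ i) u ^ k * (h' ^ i * inverse (h ^ i))) = 0" for k
      using b_eq[of k] g_neq_0 by (simp add: conjugation_power)
    from conjugations_of_u_independent[OF this s_pos] show False
      by simp
  qed
  then obtain k where "b k \<noteq> 0"
    by blast
  then have "h' = conjugation (b k) h"
    using conjugation_eqI[OF _ b_intertwines[symmetric]] by simp
  with \<open>b k \<noteq> 0\<close> b_in show thesis
    using that by blast
qed

definition fixed_field :: "'a set" where
  "fixed_field = {x \<in> E. x * g = g * x}"

lemma fixed_field_commute_coset:
  assumes "x \<in> fixed_field" "h \<in> coset"
  shows "x * h = h * x"
proof -
  obtain c where "c \<in> E" and h_eq: "h = c * g"
    using assms(2) by (auto simp: coset_def)
  have "x * c = c * x" and "x * g = g * x"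
    using commute[of x c] assms(1) \<open>c \<in> E\<close> by (auto simp: fixed_field_def)
  then show ?thesis
    unfolding h_eq by (metis mult.assoc)
qed

lemma coset_power_in_fixed_field:
  assumes "h \<in> coset"
  shows "h ^ s \<in> fixed_field"
proof -
  obtain c where "c \<in> E" "c \<noteq> 0" and h_eq: "h = c * g"
    using assms by (auto simp: coset_def)
  have "c * (h ^ s * g) = h ^ s * h"
    using commute[OF \<open>c \<in> E\<close> coset_power_in[OF assms]] by (simp add: h_eq flip: mult.assoc)
  also have "\<dots> = c * (g * h ^ s)"
    by (simp add: h_eq mult.assoc power_commutes)
  finally show ?thesis
    using \<open>c \<noteq> 0\<close> coset_power_in[OF assms] by (simp add: fixed_field_def)
qed

lemma card_conjugates_le:
  assumes finite: "finite E" and h_in: "h \<in> coset"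
  shows "card (fixed_field - {0}) * card ((\<lambda>b. conjugation b h) ` (E - {0})) \<le> card (E - {0})"
proof (rule card_image_mult_le)
  fix y assume "y \<in> (\<lambda>b. conjugation b h) ` (E - {0})"
  then obtain b where b_in: "b \<in> E - {0}" and y_eq: "y = conjugation b h"
    by blast
  have "conjugation (b * x) h = y" if "x \<in> fixed_field - {0}" for x
  proof -
    have "x * h * inverse x = h"
      using that fixed_field_commute_coset[OF _ h_in, of x] by (simp add: mult.assoc)
    moreover have "conjugation (b * x) h = b * (x * h * inverse x) * inverse b"
      using that b_in by (simp add: conjugation_def nonzero_inverse_mult_distrib mult.assoc)
    ultimately show ?thesis
      by (simp add: y_eq conjugation_def)
  qed
  then have "(\<lambda>x. b * x) ` (fixed_field - {0}) \<subseteq> {b' \<in> E - {0}. conjugation b' h = y}"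
    using b_in by (auto simp: fixed_field_def closed)
  moreover have "inj_on (\<lambda>x. b * x) (fixed_field - {0})"
    using b_in by (auto simp: inj_on_def)
  ultimately show "card (fixed_field - {0}) \<le> card {b' \<in> E - {0}. conjugation b' h = y}"
    using finite by (intro card_inj_on_le) auto
qed (use finite in simp)

text \<open>
  By Hilbert's Theorem 90, the coset is the union of the conjugacy classes of representatives of the
  \<open>s\<close>-th powers. So there are at least as many \<open>s\<close>-th powers as elements of the fixed field.
\<close>

lemma card_fixed_field_le:
  assumes finite: "finite E"
  shows "card (fixed_field - {0}) \<le> card ((\<lambda>h. h ^ s) ` coset)"
proof -
  define powers where "powers = (\<lambda>h. h ^ s) ` coset"
  define root where "root v = inv_into coset (\<lambda>h. h ^ s) v" for v
  define conjugates where "conjugates v = (\<lambda>b. conjugation b (root v)) ` (E - {0})" for v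
  have root: "root v \<in> coset" "root v ^ s = v" if "v \<in> powers" for v
    using that inv_into_into[of v "\<lambda>h. h ^ s"] f_inv_into_f[of v "\<lambda>h. h ^ s"]
    by (auto simp: root_def powers_def)
  have "finite powers"
    using finite by (simp add: powers_def coset_def)
  have "coset \<subseteq> (\<Union>v\<in>powers. conjugates v)"
  proof
    fix h assume "h \<in> coset"
    then have "h ^ s \<in> powers"
      by (simp add: powers_def)
    with conjugate_if_power_eq[OF root(1) \<open>h \<in> coset\<close> root(2)] show "h \<in> (\<Union>v\<in>powers. conjugates v)"
      unfolding conjugates_def by blast
  qed
  then have "card coset \<le> card (\<Union>v\<in>powers. conjugates v)"
    using \<open>finite powers\<close> finite by (intro card_mono) (auto simp: conjugates_def)
  also have "\<dots> \<le> (\<Sum>v\<in>powers. card (conjugates v))"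
    by (rule card_UN_le[OF \<open>finite powers\<close>])
  finally have "card (fixed_field - {0}) * card coset \<le>
      (\<Sum>v\<in>powers. card (fixed_field - {0}) * card (conjugates v))"
    unfolding sum_distrib_left[symmetric] by (rule mult_left_mono) simp
  also have "\<dots> \<le> (\<Sum>v\<in>powers. card (E - {0}))"
    unfolding conjugates_def by (intro sum_mono card_conjugates_le finite root(1))
  also have "\<dots> = card powers * card coset"
    unfolding coset_def using g_neq_0 by (subst card_image) (auto simp: inj_on_def)
  finally show ?thesis
    using closed(2) finite by (auto simp: powers_def coset_def card_gt_0_iff)
qed

lemma ex_coset_power_eq_1:
  assumes "finite E"
  obtains h where "h \<in> coset" "h ^ s = 1"
proof -
  have "(\<lambda>h. h ^ s) ` coset \<subseteq> fixed_field - {0}"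
    using coset_power_in_fixed_field coset_neq_0 by auto
  moreover have "finite (fixed_field - {0})"
    using \<open>finite E\<close> by (simp add: fixed_field_def)
  ultimately have "(\<lambda>h. h ^ s) ` coset = fixed_field - {0}"
    using card_fixed_field_le[OF \<open>finite E\<close>] by (intro card_seteq)
  moreover have "1 \<in> fixed_field - {0}"
    by (simp add: fixed_field_def closed(2))
  ultimately show thesis
    using that by (metis imageE)
qed

lemma finite_cyclic_extension_trivial:
  assumes "finite E"
  shows "s = 1"
proof (rule ccontr)
  assume "s \<noteq> 1"
  then have "1 < s"
    using s_pos by simp
  obtain h where h_in: "h \<in> coset" and "h ^ s = 1"
    using ex_coset_power_eq_1[OF \<open>finite E\<close>] .
  have "h \<noteq> 1"
  proof
    assume "h = 1"
    then have "conjugation g u = u"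
      using coset_power_mult[OF h_in u_in, of 1] by simp
    then show False
      using moves[of 1] \<open>1 < s\<close> mult_eq_conjugation_mult[OF g_neq_0, of u] by simp
  qed
  moreover have "h * intertwiner h 1 s 1 = intertwiner h 1 s 1 * 1"
    by (rule intertwiner_commute) (simp_all add: \<open>h ^ s = 1\<close>)
  then have "(h - 1) * intertwiner h 1 s 1 = 0"
    by (simp add: left_diff_distrib)
  ultimately have "(\<Sum>i<s. h ^ i) = 0"
    by (simp add: intertwiner_def)
  moreover have "conjugation (g ^ i) u ^ k * h ^ i = h ^ i * u ^ k" for i k
    using g_neq_0 coset_power_mult[OF h_in closed(8)[OF u_in]] by (simp add: conjugation_power)
  ultimately have "(\<Sum>i<s. conjugation (g ^ i) u ^ k * h ^ i) = 0" for k
    by (simp add: sum_distrib_right[symmetric])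
  from conjugations_of_u_independent[OF this s_pos] show False
    by simp
qed

end

lemma ex_cyclic_extension:
  assumes "torsion g" and gu: "g * u = u ^ j * g"
  obtains s where "cyclic_extension (div_subring_gen {u, g ^ s}) g u s"
proof -
  define s where "s = (LEAST s. s > 0 \<and> g ^ s * u = u * g ^ s)"
  have "\<exists>s. s > 0 \<and> g ^ s * u = u * g ^ s"
    using \<open>torsion g\<close> unfolding torsion_def by (metis mult_1_left mult_1_right)
  then have s_commute: "s > 0 \<and> g ^ s * u = u * g ^ s"
    unfolding s_def by (rule LeastI_ex)
  define E where "E = div_subring_gen {u, g ^ s}"
  have subring: "is_division_subring E"
    unfolding E_def by (rule division_subring_gen)
  have generators_in: "u \<in> E" "g ^ s \<in> E"
    using subset_div_subring_gen[of "{u, g ^ s}"] by (auto simp: E_def)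
  have "cyclic_extension E g u s"
  proof
    show "a * b = b * a" if "a \<in> E" "b \<in> E" for a b
      using that unfolding E_def by (rule div_subring_gen_commute[rotated]) (use s_commute in auto)
    have "conjugation g u = u ^ j" "conjugation g (g ^ s) = g ^ s"
      using torsion_neq_0[OF \<open>torsion g\<close>] gu by (simp_all add: conjugation_eqI power_commutes)
    then show "conjugation g a \<in> E" if "a \<in> E" for a
      using that generators_in division_subring_closed(8)[OF subring] unfolding E_def
      by (elim conjugation_div_subring_gen[OF torsion_neq_0[OF \<open>torsion g\<close>], rotated]) auto
    show "g ^ i * u \<noteq> u * g ^ i" if "0 < i" "i < s" for i
      using that not_less_Least[of i "\<lambda>s. s > 0 \<and> g ^ s * u = u * g ^ s"] unfolding s_def by simp
  qed (use subring torsion_neq_0[OF \<open>torsion g\<close>] s_commute generators_in in auto)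
  then show thesis
    unfolding E_def by (rule that)
qed

lemma wedderburn_little:
  assumes subring: "is_division_subring A" and finite: "finite A" and "x \<in> A" "y \<in> A"
  shows "x * y = y * x"
proof (rule ccontr)
  assume noncommuting: "x * y \<noteq> y * x"
  then have "torsion x"
    using \<open>x \<in> A\<close> by (intro finite_division_subring_torsion[OF subring finite]) auto
  then obtain g j where g_in: "g \<in> A" "g \<noteq> 0" and gx: "g * x = x ^ j * g" "g * x \<noteq> x * g"
    using torsion_conjugate_to_power[OF subring \<open>x \<in> A\<close> _ \<open>y \<in> A\<close> noncommuting] by metis
  obtain s where extension: "cyclic_extension (div_subring_gen {x, g ^ s}) g x s"
    using ex_cyclic_extension[OF finite_division_subring_torsion[OF subring finite g_in] gx(1)] .
  have "div_subring_gen {x, g ^ s} \<subseteq> A"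
    using \<open>x \<in> A\<close> g_in division_subring_closed(8)[OF subring]
    by (intro div_subring_gen_least[OF subring]) auto
  then have "finite (div_subring_gen {x, g ^ s})"
    using finite by (rule finite_subset)
  then have "s = 1"
    by (rule cyclic_extension.finite_cyclic_extension_trivial[OF extension])
  moreover have "x * g ^ s = g ^ s * x"
    using subset_div_subring_gen[of "{x, g ^ s}"]
    by (intro cyclic_extension.commute[OF extension]) auto
  ultimately show False
    using gx(2) by simp
qed

section \<open>Characteristic zero\<close>

definition eval_int_poly :: "'a::ring_1 \<Rightarrow> int poly \<Rightarrow> 'a" where
  "eval_int_poly u p = (\<Sum>i\<le>degree p. of_int (coeff p i) * u ^ i)"

lemma eval_int_poly_pCons: "eval_int_poly u (pCons c p) = of_int c + u * eval_int_poly u p"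
  by (cases "p = 0")
    (simp_all add: eval_int_poly_def sum.atMost_Suc_shift sum_distrib_left degree_pCons_eq
      mult_of_int_left_commute del: sum.atMost_Suc)

lemma eval_int_poly_0: "eval_int_poly u 0 = 0"
  by (simp add: eval_int_poly_def)

lemma eval_int_poly_add: "eval_int_poly u (p + q) = eval_int_poly u p + eval_int_poly u q"
  by (induction p q rule: poly_induct2)
    (simp_all add: eval_int_poly_0 eval_int_poly_pCons distrib_left add_ac)

lemma eval_int_poly_smult: "eval_int_poly u (Polynomial.smult c p) = of_int c * eval_int_poly u p"
  by (induction p)
    (simp_all add: eval_int_poly_0 eval_int_poly_pCons distrib_left mult_of_int_left_commute[of u])

lemma eval_int_poly_mult: "eval_int_poly u (p * q) = eval_int_poly u p * eval_int_poly u q"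
  by (induction p)
    (simp_all add: eval_int_poly_0 eval_int_poly_add eval_int_poly_smult eval_int_poly_pCons
      distrib_right mult.assoc)

lemma ring_hom_eval_int_poly: "Ring_Hom.ring_hom (eval_int_poly u)"
proof
  show "eval_int_poly u 1 = 1"
    by (simp add: one_pCons eval_int_poly_pCons eval_int_poly_0)
qed (simp_all add: eval_int_poly_0 eval_int_poly_add eval_int_poly_mult)

lemma eval_int_poly_X: "eval_int_poly u [:0, 1:] = u"
  by (simp add: eval_int_poly_pCons eval_int_poly_0)

lemma eval_int_poly_eq_sum_lessThan:
  assumes "n > 0" "u ^ n = 1"
  obtains c where "eval_int_poly u p = (\<Sum>i<n. of_int (c i) * u ^ i)"
proof -
  have "eval_int_poly u p = (\<Sum>r<n. \<Sum>i\<in>{i \<in> {..degree p}. i mod n = r}. of_int (coeff p i) * u ^ i)"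
    unfolding eval_int_poly_def using \<open>n > 0\<close> by (intro sum.group[symmetric]) auto
  also have "\<dots> = (\<Sum>r<n. of_int (\<Sum>i\<in>{i \<in> {..degree p}. i mod n = r}. coeff p i) * u ^ r)"
    unfolding of_int_sum sum_distrib_right
    by (intro sum.cong refl)
      (metis (mono_tags, lifting) power_eq_power_mod[OF \<open>u ^ n = 1\<close>] mem_Collect_eq)
  finally show thesis
    by (rule that)
qed

lemma det_eq_0_if_kernel:
  fixes v :: "nat \<Rightarrow> 'a::ring_1_no_zero_divisors"
  assumes carrier: "A \<in> carrier_mat n n"
    and kernel: "\<And>k. k < n \<Longrightarrow> (\<Sum>l<n. of_int (A $$ (k, l)) * v l) = 0"
    and "i < n" "v i \<noteq> 0"
  shows "of_int (det A) = (0 :: 'a)"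
proof -
  define B where "B = adj_mat A"
  have B_carrier: "B \<in> carrier_mat n n" and B_mult: "B * A = det A \<cdot>\<^sub>m 1\<^sub>m n"
    using adj_mat[OF carrier] by (simp_all add: B_def)
  have entries: "(\<Sum>k<n. B $$ (i, k) * A $$ (k, l)) = (if i = l then det A else 0)" if "l < n" for l
  proof -
    have "(B * A) $$ (i, l) = (\<Sum>k<n. B $$ (i, k) * A $$ (k, l))"
      using carrier B_carrier \<open>i < n\<close> that by (auto simp: scalar_prod_def atLeast0LessThan)
    then show ?thesis
      using \<open>i < n\<close> that by (auto simp: B_mult split: if_splits)
  qed
  have "of_int (det A) * v i = (\<Sum>l<n. of_int (\<Sum>k<n. B $$ (i, k) * A $$ (k, l)) * v l)"
    using \<open>i < n\<close> entries
    by (simp add: if_distrib[of of_int] if_distrib[of "\<lambda>x. x * _"] cong: if_cong)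
  also have "\<dots> = (\<Sum>k<n. of_int (B $$ (i, k)) * (\<Sum>l<n. of_int (A $$ (k, l)) * v l))"
    unfolding of_int_sum sum_distrib_right sum_distrib_left
    by (subst sum.swap) (simp add: mult.assoc)
  also have "\<dots> = 0"
    by (simp add: kernel)
  finally show ?thesis
    using \<open>v i \<noteq> 0\<close> by simp
qed

lemma cong_det:
  fixes A B :: "int mat"
  assumes "A \<in> carrier_mat n n" "B \<in> carrier_mat n n"
    and "\<And>i j. i < n \<Longrightarrow> j < n \<Longrightarrow> [A $$ (i, j) = B $$ (i, j)] (mod q)"
  shows "[det A = det B] (mod q)"
  unfolding det_def'[OF assms(1)] det_def'[OF assms(2)]
  by (intro cong_sum cong_mult cong_prod cong_refl assms(3)) (auto simp: permutes_in_image)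

text \<open>
  The powers of \<open>u\<close> are in the kernel of an integer matrix of \<open>q p(u) - 1\<close>, but this matrix is \<open>-1\<close>
  modulo \<open>q\<close>.
\<close>

lemma of_int_mult_eval_int_poly_neq_1:
  fixes u :: "'a::division_ring"
  assumes "CHAR('a) = 0" "torsion u" "q > 1"
  shows "of_int q * eval_int_poly u p \<noteq> 1"
proof
  assume unit: "of_int q * eval_int_poly u p = 1"
  interpret Ring_Hom.ring_hom "eval_int_poly u"
    by (rule ring_hom_eval_int_poly)
  obtain n where "n > 0" "u ^ n = 1"
    using \<open>torsion u\<close> by (auto simp: torsion_def)
  then have "\<exists>c. eval_int_poly u ([:0, 1:] ^ k * p) = (\<Sum>i<n. of_int (c i) * u ^ i)" for k
    using eval_int_poly_eq_sum_lessThan by blast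
  then obtain c where row: "u ^ k * eval_int_poly u p = (\<Sum>i<n. of_int (c k i) * u ^ i)" for k
    unfolding hom_mult hom_power eval_int_poly_X by metis
  define A where "A = mat n n (\<lambda>(k, i). q * c k i - (if i = k then 1 else 0))"
  have kernel: "(\<Sum>i<n. of_int (A $$ (k, i)) * u ^ i) = 0" if "k < n" for k
  proof -
    have "(\<Sum>i<n. of_int (A $$ (k, i)) * u ^ i) =
        of_int q * (\<Sum>i<n. of_int (c k i) * u ^ i) - (\<Sum>i<n. (if i = k then 1 else 0) * u ^ i)"
      using that by (simp add: A_def left_diff_distrib sum_subtractf sum_distrib_left mult.assoc
          if_distrib[of of_int] cong: if_cong)
    also have "\<dots> = of_int q * (u ^ k * eval_int_poly u p) - u ^ k"
      using that by (simp add: row if_distrib[of "\<lambda>x. x * _"] cong: if_cong)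
    finally show ?thesis
      by (simp add: mult_of_int_left_commute[symmetric] unit)
  qed
  have "of_int (det A) = (0 :: 'a)"
    by (rule det_eq_0_if_kernel[of A n "(^) u" 0]) (use kernel \<open>n > 0\<close> in \<open>auto simp: A_def\<close>)
  then have "det A = 0"
    using \<open>CHAR('a) = 0\<close> by (simp add: of_int_eq_0_iff_char_dvd)
  moreover have "[det A = det (- 1 \<cdot>\<^sub>m 1\<^sub>m n)] (mod q)"
    by (rule cong_det) (auto simp: A_def cong_iff_dvd_diff)
  ultimately have "q dvd (- 1) ^ n"
    by (simp add: cong_iff_dvd_diff)
  then show False
    using \<open>q > 1\<close> by (simp add: minus_one_power_iff split: if_splits)
qed

lemma dvd_power_minus_1: "d dvd x - 1 \<Longrightarrow> d dvd x ^ k - (1 :: 'a::comm_ring_1)"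
  by (simp add: power_diff_1_eq)

lemma dvd_geometric_sum2:
  fixes x y :: "'a::comm_ring_1"
  assumes "d dvd x - 1" "d dvd y - 1"
  shows "d dvd (\<Sum>i<m. x ^ i * y ^ (m - Suc i)) - of_nat m"
proof -
  have "d dvd x ^ i * y ^ k - 1" for i k
  proof -
    have "x ^ i * y ^ k - 1 = x ^ i * (y ^ k - 1) + (x ^ i - 1)"
      by (simp add: algebra_simps)
    then show ?thesis
      using assms by (simp only: dvd_add dvd_mult dvd_power_minus_1)
  qed
  then have "d dvd (\<Sum>i<m. x ^ i * y ^ (m - Suc i) - 1)"
    by (rule dvd_sum)
  then show ?thesis
    by (simp add: sum_subtractf)
qed

lemma eq_if_power_eq_coprime:
  fixes hom :: "'r::comm_ring_1 \<Rightarrow> 'a::division_ring"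
  assumes "Ring_Hom.ring_hom hom" and no_inverse: "\<And>r. of_int d * hom r \<noteq> 1"
    and "coprime (int m) d" and dvd: "of_int d dvd x - 1" "of_int d dvd y - 1"
    and power_eq: "hom (x ^ m) = hom (y ^ m)"
  shows "hom x = hom y"
proof -
  interpret Ring_Hom.ring_hom hom by fact
  obtain r where r_eq: "(\<Sum>i<m. x ^ i * y ^ (m - Suc i)) = of_nat m + of_int d * r"
    using dvd_geometric_sum2[OF dvd, of m] by (metis add.commute diff_add_cancel dvdE)
  have "(x - y) * (of_nat m + of_int d * r) = x ^ m - y ^ m"
    unfolding r_eq[symmetric] by (simp only: power_diff_sumr2[of x m y] mult.commute)
  from arg_cong[OF this, of hom] have "(hom x - hom y) * hom (of_nat m + of_int d * r) = 0"
    using power_eq by (simp only: hom_mult hom_minus) simp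
  moreover have "hom (of_nat m + of_int d * r) \<noteq> 0"
  proof
    assume zero: "hom (of_nat m + of_int d * r) = 0"
    obtain a b where bezout: "a * int m + b * d = 1"
      using bezout_int[of "int m" d] \<open>coprime (int m) d\<close> by auto
    have "of_int d * (of_int b - of_int a * r) =
        of_int (a * int m + b * d) - of_int a * (of_nat m + of_int d * r)"
      by (simp add: algebra_simps)
    then have "of_int d * hom (of_int b - of_int a * r) =
        hom (1 - of_int a * (of_nat m + of_int d * r))"
      by (simp only: bezout of_int_1 hom_of_int[symmetric] hom_mult[symmetric])
    also have "\<dots> = 1"
      by (simp only: hom_minus hom_mult zero) simp
    finally show False
      using no_inverse by blast
  qed
  ultimately show ?thesis
    by simp
qed

lemma eq_if_cube_eq:
  fixes hom :: "'r::comm_ring_1 \<Rightarrow> 'a::division_ring"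
  assumes "Ring_Hom.ring_hom hom" and "(3 :: 'a) \<noteq> 0" and no_inverse: "\<And>r. 3 * hom r \<noteq> 1"
    and dvd: "3 dvd x - 1" "3 dvd y - 1" and cube_eq: "hom (x ^ 3) = hom (y ^ 3)"
  shows "hom x = hom y"
proof -
  interpret Ring_Hom.ring_hom hom by fact
  obtain a b where x_eq: "x = 1 + 3 * a" and y_eq: "y = 1 + 3 * b"
    using dvd by (metis dvdE add.commute diff_add_cancel)
  define t where "t = a + b + a\<^sup>2 + a * b + b\<^sup>2"
  have "(x - y) * (3 * (1 + 3 * t)) = x ^ 3 - y ^ 3"
    unfolding x_eq y_eq t_def by (simp add: power2_eq_square power3_eq_cube algebra_simps)
  then have "hom ((x - y) * (3 * (1 + 3 * t))) = 0"
    using cube_eq by (simp only: hom_minus) simp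
  then have "(hom x - hom y) * (3 * (1 + 3 * hom t)) = 0"
    by (simp only: hom_mult hom_minus hom_add hom_one hom_numeral)
  moreover have "1 + 3 * hom t \<noteq> 0"
    using no_inverse[of "- t"] by (auto simp: hom_uminus add_eq_0_iff2)
  ultimately show ?thesis
    using \<open>3 \<noteq> 0\<close> by (simp only: mult_eq_0_iff right_minus_eq) simp
qed

lemma eq_if_power_eq_mod_3:
  fixes hom :: "'r::comm_ring_1 \<Rightarrow> 'a::division_ring"
  assumes ring_hom: "Ring_Hom.ring_hom hom" and "(3 :: 'a) \<noteq> 0" and no_inverse: "\<And>r. 3 * hom r \<noteq> 1"
    and "m > 0" "3 dvd x - 1" "3 dvd y - 1" "hom (x ^ m) = hom (y ^ m)"
  shows "hom x = hom y"
  using assms(4-)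
proof (induction m arbitrary: x y rule: less_induct)
  case (less m)
  show ?case
  proof (cases "3 dvd m")
    case False
    then have "coprime (int m) 3"
      using prime_imp_coprime[of "3::int" "int m"]
      by (simp add: coprime_commute int_dvd_int_iff[of 3, simplified])
    then show ?thesis
      by (rule eq_if_power_eq_coprime[OF ring_hom, rotated])
        (use less.prems no_inverse in simp_all)
  next
    case True
    then obtain k where m_eq: "m = k * 3"
      by (metis dvdE mult.commute)
    have "hom (x ^ k) = hom (y ^ k)"
    proof (rule eq_if_cube_eq[OF ring_hom \<open>3 \<noteq> 0\<close> no_inverse])
      show "3 dvd x ^ k - 1" "3 dvd y ^ k - 1"
        using less.prems(2,3) by (simp_all add: dvd_power_minus_1)
      show "hom ((x ^ k) ^ 3) = hom ((y ^ k) ^ 3)"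
        using less.prems(4) by (simp only: m_eq power_mult)
    qed
    moreover have "0 < k" "k < m"
      using m_eq less.prems(1) by auto
    ultimately show ?thesis
      using less.IH less.prems(2,3) by blast
  qed
qed

lemma one_plus_central_mult_neq_0:
  fixes g u z :: "'a::division_ring"
  assumes "z * g = g * z" "g * u \<noteq> u * g"
  shows "1 + z * u \<noteq> 0"
proof
  assume "1 + z * u = 0"
  then have "z * (- u) = 1"
    by (simp add: add_eq_0_iff2)
  then have "inverse z = - u"
    by (rule inverse_unique)
  then show False
    using assms mult_commute_imp_mult_inverse_commute[OF assms(1)] by simp
qed

lemma commutator_one_plus_central_mult:
  fixes g u z :: "'a::division_ring"
  assumes "g \<noteq> 0" and gu: "g * u = u ^ j * g" and central: "z * g = g * z" "z * u = u * z"
    and neq_0: "1 + z * u \<noteq> 0"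
  shows "commutator g (1 + z * u) * (1 + z * u) = 1 + z * u ^ j"
    and "commutator g (1 + z * u) * u = u * commutator g (1 + z * u)"
proof -
  have "conjugation g 1 = 1" "conjugation g z = z" "conjugation g u = u ^ j"
    using \<open>g \<noteq> 0\<close> gu central by (simp_all add: conjugation_eqI)
  then show mult_eq: "commutator g (1 + z * u) * (1 + z * u) = 1 + z * u ^ j"
    by (simp add: commutator_mult neq_0 conjugation_add conjugation_mult \<open>g \<noteq> 0\<close>)
  have u_commute: "(1 + z * u ^ i) * u = u * (1 + z * u ^ i)" for i
  proof -
    have "z * u ^ i * u = u * (z * u ^ i)"
      by (metis central(2) mult.assoc power_commutes)
    then show ?thesis
      by (simp add: distrib_left distrib_right)
  qed
  have "inverse (1 + z * u) * u = u * inverse (1 + z * u)"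
    using u_commute[of 1] by (intro mult_commute_imp_mult_inverse_commute) simp
  moreover have "commutator g (1 + z * u) = (1 + z * u ^ j) * inverse (1 + z * u)"
    using neq_0 by (simp add: mult_eq[symmetric] mult.assoc)
  ultimately show "commutator g (1 + z * u) * u = u * commutator g (1 + z * u)"
    using u_commute[of j] by (metis mult.assoc)
qed

lemma commuting_power_mult_distrib:
  fixes x y :: "'a::monoid_mult"
  assumes "x * y = y * x"
  shows "(x * y) ^ n = x ^ n * y ^ n"
proof (induction n)
  case (Suc n)
  have "(x * y) ^ Suc n = x * (y * x ^ n) * y ^ n"
    by (simp add: Suc mult.assoc)
  also have "y * x ^ n = x ^ n * y"
    using power_commuting_commutes[OF assms, of n] by simp
  finally show ?case
    by (simp add: mult.assoc)
qed simp

lemma one_plus_central_mult_power_eq: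
  fixes g u z :: "'a::division_ring"
  assumes "g \<noteq> 0" "g * u = u ^ j * g" and central: "\<And>x. z * x = x * z"
    and "1 + z * u \<noteq> 0" and torsion: "torsion (commutator g (1 + z * u))"
  obtains m where "m > 0" "(1 + z * u ^ j) ^ m = (1 + z * u) ^ m"
proof -
  define c where "c = commutator g (1 + z * u)"
  obtain m where "m > 0" "c ^ m = 1"
    using torsion by (auto simp: torsion_def c_def)
  have c_mult: "c * (1 + z * u) = 1 + z * u ^ j" and c_commute: "c * u = u * c"
    unfolding c_def
    by (rule commutator_one_plus_central_mult[OF assms(1,2) central central assms(4)])+
  have "c * (z * u) = z * u * c"
    by (metis c_commute central mult.assoc)
  then have "c * (1 + z * u) = (1 + z * u) * c"
    by (simp add: distrib_left distrib_right)
  from commuting_power_mult_distrib[OF this, of m] show thesis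
    using that[OF \<open>m > 0\<close>] by (simp add: c_mult \<open>c ^ m = 1\<close>)
qed

lemma conjugate_power_eq_char_0:
  fixes g u :: "'a::division_ring"
  assumes "CHAR('a) = 0" "torsion u" "g \<noteq> 0" "g * u = u ^ j * g"
    and "1 + 3 * u \<noteq> 0" "torsion (commutator g (1 + 3 * u))"
  shows "u ^ j = u"
proof -
  interpret Ring_Hom.ring_hom "eval_int_poly u"
    by (rule ring_hom_eval_int_poly)
  have "3 * x = x * 3" for x :: 'a
    using mult_of_int_commute[of 3 x] by simp
  then obtain m where "m > 0" and power_eq: "(1 + 3 * u ^ j) ^ m = (1 + 3 * u) ^ m"
    using one_plus_central_mult_power_eq[OF assms(3,4) _ assms(5,6)] by metis
  define x y :: "int poly" where "x = 1 + 3 * [:0, 1:] ^ j" and "y = 1 + 3 * [:0, 1:]"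
  have eval: "eval_int_poly u x = 1 + 3 * u ^ j" "eval_int_poly u y = 1 + 3 * u"
    by (simp_all only: x_def y_def hom_add hom_one hom_mult hom_numeral hom_power eval_int_poly_X)
  have "(3 :: 'a) \<noteq> 0"
    using \<open>CHAR('a) = 0\<close> of_nat_eq_0_iff_char_dvd[where 'a = 'a, of 3] by simp
  have "eval_int_poly u x = eval_int_poly u y"
  proof (rule eq_if_power_eq_mod_3[OF ring_hom_eval_int_poly \<open>3 \<noteq> 0\<close> _ \<open>m > 0\<close>])
    show "3 * eval_int_poly u p \<noteq> 1" for p
      using of_int_mult_eval_int_poly_neq_1[OF assms(1,2), of 3 p] by simp
    show "3 dvd x - 1" "3 dvd y - 1"
      by (simp_all only: x_def y_def add_diff_cancel_left' dvd_triv_left)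
    show "eval_int_poly u (x ^ m) = eval_int_poly u (y ^ m)"
      by (simp only: hom_power eval power_eq)
  qed
  then show ?thesis
    using \<open>3 \<noteq> 0\<close> by (simp add: eval)
qed

section \<open>Positive characteristic\<close>

lemma finite_range_of_int:
  assumes "CHAR('a) > 0"
  shows "finite (range (of_int :: int \<Rightarrow> 'a::ring_1))"
proof -
  have "of_int k = (of_int (k mod int CHAR('a)) :: 'a)" for k
    by (simp add: of_int_eq_iff_cong_CHAR)
  then have "range (of_int :: int \<Rightarrow> 'a) \<subseteq> of_int ` {0..<int CHAR('a)}"
    using assms by (auto intro!: image_eqI[of _ _ "_ mod int CHAR('a)"])
  then show ?thesis
    by (rule finite_subset) simp
qed

lemma finite_subring_is_division_subring:
  fixes C :: "'a::division_ring set"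
  assumes finite: "finite C" and one: "1 \<in> C"
    and add: "\<And>x y. x \<in> C \<Longrightarrow> y \<in> C \<Longrightarrow> x + y \<in> C"
    and mult: "\<And>x y. x \<in> C \<Longrightarrow> y \<in> C \<Longrightarrow> x * y \<in> C" and minus: "\<And>x. x \<in> C \<Longrightarrow> - x \<in> C"
  shows "is_division_subring C"
proof -
  have "inverse x \<in> C" if "x \<in> C" "x \<noteq> 0" for x
  proof -
    have power: "x ^ k \<in> C" for k
      using \<open>x \<in> C\<close> one mult by (induction k) auto
    then have "torsion x"
      using torsion_if_finite_orbit[OF \<open>x \<noteq> 0\<close> one_neq_zero finite] by simp
    then obtain m where "m > 0" "x ^ m = 1"
      by (auto simp: torsion_def)
    then have "x * x ^ (m - 1) = 1"
      by (simp flip: power_Suc)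
    then have "inverse x = x ^ (m - 1)"
      by (rule inverse_unique)
    then show ?thesis
      using power by simp
  qed
  moreover have "0 \<in> C"
    using add[OF one minus[OF one]] by simp
  ultimately show ?thesis
    by (simp add: is_division_subring_def one add mult minus)
qed

lemma finite_div_subring_gen_empty:
  assumes "CHAR('a::division_ring) > 0"
  shows "finite (div_subring_gen ({} :: 'a set))"
proof -
  have "is_division_subring (range (of_int :: int \<Rightarrow> 'a))"
    by (rule finite_subring_is_division_subring[OF finite_range_of_int[OF assms]])
      (auto simp flip: of_int_add of_int_mult of_int_minus intro: range_eqI[of _ _ 1])
  then have "div_subring_gen {} \<subseteq> range (of_int :: int \<Rightarrow> 'a)"
    by (rule div_subring_gen_least) simp
  then show ?thesis
    using finite_range_of_int[OF assms] finite_subset by blast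
qed

lemma division_subring_left_span_powers:
  fixes C :: "'a::division_ring set"
  assumes subring: "is_division_subring C" and "finite C" "torsion t"
    and normalizes: "\<And>c. c \<in> C \<Longrightarrow> conjugation t c \<in> C"
  shows "is_division_subring (left_span C (range ((^) t)))" (is "is_division_subring ?V")
proof (rule finite_subring_is_division_subring)
  have power_in: "t ^ i \<in> ?V" for i
    by (intro left_span_base subring finite_range_power \<open>torsion t\<close>) simp
  then show "1 \<in> ?V"
    by (metis power_0)
  show "- x \<in> ?V" if "x \<in> ?V" for x
    using left_span_scale[OF subring _ that, of "- 1"] division_subring_closed(2,5)[OF subring]
    by simp
  have t_mult: "t * x \<in> ?V" if "x \<in> ?V" for x
    using that
  proof (rule left_span_semilinear[OF subring, rotated 2])
    show "\<exists>c'\<in>C. t * c = c' * t" if "c \<in> C" for c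
      using normalizes[OF that] mult_eq_conjugation_mult[OF torsion_neq_0[OF \<open>torsion t\<close>]] by blast
    show "t * b \<in> ?V" if "b \<in> range ((^) t)" for b
      using that power_in[of "Suc _"] by auto
  qed
  have power_mult: "t ^ i * x \<in> ?V" if "x \<in> ?V" for i x
    using that by (induction i) (auto simp: mult.assoc t_mult)
  show "x * y \<in> ?V" if "x \<in> ?V" "y \<in> ?V" for x y
  proof -
    obtain c where scalars: "\<And>b. b \<in> range ((^) t) \<Longrightarrow> c b \<in> C"
      and x_eq: "x = (\<Sum>b\<in>range ((^) t). c b * b)"
      using \<open>x \<in> ?V\<close> by (auto elim!: left_spanE)
    have "c b * (b * y) \<in> ?V" if "b \<in> range ((^) t)" for b
      by (rule left_span_scale[OF subring scalars[OF that]])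
        (use that power_mult[OF \<open>y \<in> ?V\<close>] in auto)
    then show ?thesis
      unfolding x_eq sum_distrib_right mult.assoc by (rule left_span_sum[OF subring])
  qed
qed (use assms in \<open>auto intro: left_span_add finite_left_span finite_range_power\<close>)

lemma finite_div_subring_gen_insert:
  assumes finite: "finite (div_subring_gen S)" and "torsion t"
    and normalizes: "\<And>x. x \<in> S \<Longrightarrow> conjugation t x \<in> div_subring_gen S"
  shows "finite (div_subring_gen (insert t S))"
proof -
  define V where "V = left_span (div_subring_gen S) (range ((^) t))"
  have power_in: "t ^ i \<in> V" for i
    unfolding V_def
    by (intro left_span_base division_subring_gen finite_range_power \<open>torsion t\<close>) simp
  then have "c * t ^ 0 \<in> V" if "c \<in> div_subring_gen S" for c
    using that unfolding V_def by (intro left_span_scale[OF division_subring_gen])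
  then have "insert t S \<subseteq> V"
    using power_in[of 1] subset_div_subring_gen[of S] by auto
  moreover have "is_division_subring V"
    unfolding V_def
    by (intro division_subring_left_span_powers division_subring_gen finite \<open>torsion t\<close>
        conjugation_div_subring_gen[OF torsion_neq_0[OF \<open>torsion t\<close>] normalizes])
  ultimately have "div_subring_gen (insert t S) \<subseteq> V"
    by (intro div_subring_gen_least)
  moreover have "finite V"
    unfolding V_def by (intro finite_left_span finite finite_range_power \<open>torsion t\<close>)
  ultimately show ?thesis
    by (rule finite_subset)
qed

lemma finite_div_subring_gen_commuting:
  fixes T :: "'a::division_ring set"
  assumes char_pos: "CHAR('a) > 0" and "finite T" "\<And>t. t \<in> T \<Longrightarrow> t \<noteq> 0 \<Longrightarrow> torsion t"
    and "\<And>s t. s \<in> T \<Longrightarrow> t \<in> T \<Longrightarrow> s * t = t * s"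
  shows "finite (div_subring_gen T)"
  using assms(2-)
proof (induction T)
  case empty
  show ?case
    by (rule finite_div_subring_gen_empty[OF char_pos])
next
  case (insert t T)
  then have finite: "finite (div_subring_gen T)"
    by auto
  show ?case
  proof (cases "t = 0")
    case True
    then have "div_subring_gen (insert t T) \<subseteq> div_subring_gen T"
      using subset_div_subring_gen[of T] division_subring_closed(1)[OF division_subring_gen]
      by (intro div_subring_gen_least division_subring_gen) auto
    then show ?thesis
      using finite by (rule finite_subset)
  next
    case False
    then have "conjugation t x = x" if "x \<in> T" for x
      using that insert.prems(2) by (intro conjugation_eqI) auto
    then show ?thesis
      using insert.prems(1) False subset_div_subring_gen[of T]
      by (intro finite_div_subring_gen_insert finite) auto
  qed
qed

lemma ex_finite_stable_left_span:
  fixes K :: "'a::division_ring set"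
  assumes char_pos: "CHAR('a) > 0" and subring: "is_division_subring K"
    and center_torsion: "\<And>z. z \<in> rel_center K \<Longrightarrow> z \<noteq> 0 \<Longrightarrow> torsion z"
    and "finite B" "B \<subseteq> K" "K \<subseteq> left_span (rel_center K) B" "g \<in> K"
  obtains C where "is_division_subring C" "finite C" "\<And>x. x \<in> left_span C B \<Longrightarrow> g * x \<in> left_span C B"
proof -
  have "g * b \<in> left_span (rel_center K) B" if "b \<in> B" for b
    using that assms(5-7) division_subring_closed(4)[OF subring] by blast
  then have "\<exists>c. (\<forall>b'\<in>B. c b' \<in> rel_center K) \<and> g * b = (\<Sum>b'\<in>B. c b' * b')" if "b \<in> B" for b
    using that by (fastforce elim: left_spanE)
  then obtain c where scalars: "\<And>b b'. b \<in> B \<Longrightarrow> b' \<in> B \<Longrightarrow> c b b' \<in> rel_center K"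
    and g_mult_base: "\<And>b. b \<in> B \<Longrightarrow> g * b = (\<Sum>b'\<in>B. c b b' * b')"
    by metis
  define T where "T = (\<lambda>(b, b'). c b b') ` (B \<times> B)"
  have "finite T" and T_central: "T \<subseteq> rel_center K"
    using \<open>finite B\<close> scalars by (auto simp: T_def)
  have "s * t = t * s" if "s \<in> T" "t \<in> T" for s t
    using that T_central rel_center_subset[of K] by (intro rel_center_commute[of s K]) auto
  then have "finite (div_subring_gen T)"
    using center_torsion \<open>finite T\<close> T_central
    by (intro finite_div_subring_gen_commuting[OF char_pos]) auto
  moreover have "g * x \<in> left_span (div_subring_gen T) B"
    if "x \<in> left_span (div_subring_gen T) B" for x
    using that
  proof (rule left_span_semilinear[OF division_subring_gen, rotated 2])
    show "\<exists>c'\<in>div_subring_gen T. g * c = c' * g" if "c \<in> div_subring_gen T" for c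
    proof -
      have "c \<in> rel_center K"
        using that div_subring_gen_least[OF division_subring_rel_center[OF subring] T_central]
        by blast
      then show ?thesis
        using that rel_center_commute[OF _ \<open>g \<in> K\<close>, of c] by (intro bexI[of _ c]) auto
    qed
    show "g * b \<in> left_span (div_subring_gen T) B" if "b \<in> B" for b
      unfolding g_mult_base[OF that] using that subset_div_subring_gen[of T]
      by (intro left_spanI) (auto simp: T_def)
  qed
  ultimately show thesis
    using that[OF division_subring_gen] by blast
qed

lemma torsion_if_center_torsion:
  fixes K :: "'a::division_ring set"
  assumes char_pos: "CHAR('a) > 0" and subring: "is_division_subring K"
    and fin_dim: "fin_dim_over_center K"
    and center_torsion: "\<And>z. z \<in> rel_center K \<Longrightarrow> z \<noteq> 0 \<Longrightarrow> torsion z"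
    and "g \<in> K" "g \<noteq> 0"
  shows "torsion g"
proof -
  obtain B where spanning: "finite B" "B \<subseteq> K" "K \<subseteq> left_span (rel_center K) B"
    using fin_dim by (auto simp: fin_dim_over_center_iff)
  obtain b where "b \<in> B" "b \<noteq> 0"
  proof (rule ccontr)
    assume "\<not> thesis"
    then have "left_span (rel_center K) B \<subseteq> {0}"
      using that by (force elim!: left_spanE intro!: sum.neutral)
    then show False
      using spanning(3) division_subring_closed(2)[OF subring] by auto
  qed
  obtain C where "is_division_subring C" "finite C"
    and stable: "\<And>x. x \<in> left_span C B \<Longrightarrow> g * x \<in> left_span C B"
    using ex_finite_stable_left_span[OF char_pos subring center_torsion spanning \<open>g \<in> K\<close>] by metis
  have "g ^ k * b \<in> left_span C B" for k
    using left_span_base[OF \<open>is_division_subring C\<close> spanning(1) \<open>b \<in> B\<close>]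
    by (induction k) (auto simp: mult.assoc stable)
  moreover have "finite (left_span C B)"
    by (intro finite_left_span \<open>finite C\<close> spanning(1))
  ultimately show ?thesis
    by (intro torsion_if_finite_orbit[OF \<open>g \<noteq> 0\<close> \<open>b \<noteq> 0\<close>])
qed

lemma central_torsion_char_pos:
  fixes g u z :: "'a::division_ring"
  assumes char_pos: "CHAR('a) > 0" and "torsion u"
    and "g \<noteq> 0" and gu: "g * u = u ^ j * g" "g * u \<noteq> u * g"
    and "z \<noteq> 0" and central: "z * g = g * z" "z * u = u * z"
    and commutator_torsion: "torsion (commutator g (1 + z * u))"
  shows "torsion z"
proof -
  define c where "c = commutator g (1 + z * u)"
  have "1 + z * u \<noteq> 0"
    by (rule one_plus_central_mult_neq_0[OF central(1) gu(2)])
  then have c_mult: "c * (1 + z * u) = 1 + z * u ^ j" and c_commute: "c * u = u * c"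
    unfolding c_def by (rule commutator_one_plus_central_mult[OF \<open>g \<noteq> 0\<close> gu(1) central])+
  define E where "E = div_subring_gen {c, u}"
  have subring: "is_division_subring E" and generators_in: "c \<in> E" "u \<in> E"
    unfolding E_def using subset_div_subring_gen[of "{c, u}"] by (auto intro: division_subring_gen)
  have "finite E"
    unfolding E_def using \<open>torsion u\<close> commutator_torsion c_commute
    by (intro finite_div_subring_gen_commuting[OF char_pos]) (auto simp: c_def)
  have "z * u ^ j = u ^ j * z"
    using power_commuting_commutes[of u z j] central(2) by simp
  then have z_eq: "(u ^ j - c * u) * z = c - 1"
    using c_mult by (simp add: distrib_left left_diff_distrib central(2) algebra_simps)
  have "u ^ j - c * u \<noteq> 0"
  proof
    assume "u ^ j - c * u = 0"
    with z_eq have "c = 1"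
      by simp
    with \<open>u ^ j - c * u = 0\<close> gu show False
      by simp
  qed
  with z_eq have "z = inverse (u ^ j - c * u) * (c - 1)"
    by (metis inverse_mult_cancel_left(1))
  also have "\<dots> \<in> E"
    using generators_in by (intro division_subring_closed[OF subring])
  finally show ?thesis
    by (rule finite_division_subring_torsion[OF subring \<open>finite E\<close> _ \<open>z \<noteq> 0\<close>])
qed

lemma commute_if_normalizes_char_pos:
  fixes g u :: "'a::division_ring"
  assumes char_pos: "CHAR('a) > 0" and "torsion u" "torsion g" and gu: "g * u = u ^ j * g"
  shows "g * u = u * g"
proof -
  have "conjugation g u = u ^ j"
    using torsion_neq_0[OF \<open>torsion g\<close>] gu by (rule conjugation_eqI)
  moreover have "u ^ j \<in> div_subring_gen {u}"
    using subset_div_subring_gen[of "{u}"]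
    by (intro division_subring_closed(8) division_subring_gen) auto
  moreover have "finite (div_subring_gen {u})"
    using \<open>torsion u\<close> by (intro finite_div_subring_gen_commuting[OF char_pos]) auto
  ultimately have "finite (div_subring_gen {g, u})"
    using \<open>torsion g\<close> by (intro finite_div_subring_gen_insert[of "{u}" g]) auto
  then show ?thesis
    using subset_div_subring_gen[of "{g, u}"]
    by (intro wedderburn_little[OF division_subring_gen]) auto
qed

section \<open>Torsion commutators\<close>

lemma ex_noncommuting_conjugate_to_power:
  fixes K :: "'a::division_ring set"
  assumes subring: "is_division_subring K"
    and torsion_commutators: "\<And>a b. a \<in> K \<Longrightarrow> b \<in> K \<Longrightarrow> a \<noteq> 0 \<Longrightarrow> b \<noteq> 0 \<Longrightarrow> torsion (commutator a b)"
    and "x \<in> K" "y \<in> K" and noncommuting: "x * y \<noteq> y * x"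
  obtains u g j where "u \<in> K" "torsion u" "g \<in> K" "g \<noteq> 0" "g * u = u ^ j * g" "g * u \<noteq> u * g"
proof -
  have "x \<noteq> 0"
    using noncommuting by auto
  obtain b where "b \<in> K" "b \<noteq> 0" and noncentral: "commutator x b \<notin> rel_center K"
    using ex_noncentral_commutator[OF subring \<open>x \<in> K\<close> \<open>y \<in> K\<close> noncommuting] .
  have u_in: "commutator x b \<in> K"
    by (intro commutator_closed subring \<open>x \<in> K\<close> \<open>b \<in> K\<close>)
  have u_torsion: "torsion (commutator x b)"
    by (intro torsion_commutators \<open>x \<in> K\<close> \<open>b \<in> K\<close> \<open>x \<noteq> 0\<close> \<open>b \<noteq> 0\<close>)
  obtain w where "w \<in> K" "commutator x b * w \<noteq> w * commutator x b"
    using noncentral u_in by (auto simp: rel_center_def)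
  from torsion_conjugate_to_power[OF subring u_in u_torsion this] show thesis
    using that[OF u_in u_torsion] by metis
qed

lemma commute_if_torsion_commutators:
  fixes K :: "'a::division_ring set"
  assumes subring: "is_division_subring K" and fin_dim: "fin_dim_over_center K"
    and torsion_commutators: "\<And>a b. a \<in> K \<Longrightarrow> b \<in> K \<Longrightarrow> a \<noteq> 0 \<Longrightarrow> b \<noteq> 0 \<Longrightarrow> torsion (commutator a b)"
    and "x \<in> K" "y \<in> K"
  shows "x * y = y * x"
proof (rule ccontr)
  assume noncommuting: "x * y \<noteq> y * x"
  obtain u g j where "u \<in> K" "torsion u" and g_in: "g \<in> K" "g \<noteq> 0"
    and gu: "g * u = u ^ j * g" "g * u \<noteq> u * g"
    using ex_noncommuting_conjugate_to_power[OF subring _ assms(4,5) noncommuting]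
      torsion_commutators by metis
  have one_plus: "1 + z * u \<noteq> 0" "torsion (commutator g (1 + z * u))" if "z \<in> rel_center K" for z
  proof -
    have "z * g = g * z" "z \<in> K"
      using that g_in(1) rel_center_subset[of K] by (auto intro: rel_center_commute)
    then show "1 + z * u \<noteq> 0"
      by (intro one_plus_central_mult_neq_0[OF _ gu(2)])
    then show "torsion (commutator g (1 + z * u))"
      using g_in \<open>u \<in> K\<close> \<open>z \<in> K\<close>
      by (simp add: torsion_commutators division_subring_closed[OF subring])
  qed
  show False
  proof (cases "CHAR('a) = 0")
    case True
    have "u ^ j = u"
      using one_plus[of 3] of_int_in_rel_center[OF subring, of 3]
      by (intro conjugate_power_eq_char_0[OF True \<open>torsion u\<close> g_in(2) gu(1)]) auto
    with gu show False
      by simp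
  next
    case False
    then have char_pos: "CHAR('a) > 0"
      by simp
    have "torsion z" if "z \<in> rel_center K" "z \<noteq> 0" for z
      using one_plus(2)[OF that(1)] rel_center_commute[OF that(1)] g_in(1) \<open>u \<in> K\<close>
      by (intro central_torsion_char_pos[OF char_pos \<open>torsion u\<close> g_in(2) gu that(2)]) simp_all
    then have "torsion g"
      by (intro torsion_if_center_torsion[OF char_pos subring fin_dim _ g_in])
    from commute_if_normalizes_char_pos[OF char_pos \<open>torsion u\<close> this gu(1)] gu(2) show False
      by contradiction
  qed
qed

theorem theorem6p3:
  assumes "weakly_locally_finite TYPE('a::division_ring)"
    and "\<forall>a b::'a. a \<noteq> 0 \<longrightarrow> b \<noteq> 0 \<longrightarrow>
           (\<exists>n::nat. n > 0 \<and> (a * b * inverse a * inverse b) ^ n \<in> center)"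
  shows "\<forall>x y::'a. x * y = y * x"
proof (intro allI)
  fix x y :: 'a
  define K where "K = div_subring_gen {x, y}"
  have subring: "is_division_subring K" and fin_dim: "fin_dim_over_center K"
    using assms(1) by (simp_all add: K_def division_subring_gen weakly_locally_finite_def)
  have "x \<in> K" "y \<in> K"
    using subset_div_subring_gen[of "{x, y}"] by (auto simp: K_def)
  obtain N e where "basis_over_center K N e"
    using ex_basis_over_center[OF subring fin_dim] .
  then interpret basis_over_center K N e .
  have "torsion (commutator a b)" if ab_in: "a \<in> K" "b \<in> K" and nonzero: "a \<noteq> 0" "b \<noteq> 0" for a b
  proof -
    obtain n where "n > 0" "commutator a b ^ n \<in> center"
      using assms(2) nonzero by (auto simp: commutator_def)
    moreover have "commutator a b ^ n \<in> K"
      by (intro closed(8) commutator_closed subring ab_in)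
    ultimately show ?thesis
      by (intro torsion_commutator_if_power_central[OF ab_in nonzero, of n])
        (simp_all add: center_def rel_center_def)
  qed
  then show "x * y = y * x"
    by (rule commute_if_torsion_commutators[OF subring fin_dim _ \<open>x \<in> K\<close> \<open>y \<in> K\<close>])
qed

end
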